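(* With $\mathcal{A}$, $L$ and $\bar\rho_\blacktriangleright:\mathsf{Sym}(L)\to\mathrm{End}(\mathcal{A})$ as defined in the context: for all $\beta\in\mathcal{M}$ the set $$\left\{(u,\mathsf z^\gamma)\in\overline{\mathcal{B}}_{\mathsf{Sym}(L)}\times\mathcal{B}_\mathcal{A}:\ \langle\bar\rho_\blacktriangleright(u)(\mathsf z^\gamma),\mathsf z^\beta\rangle\neq0\right\}$$ is finite, where $\overline{\mathcal{B}}_{\mathsf{Sym}(L)}$ is the monomial basis of $\mathsf{Sym}(L)$, $\mathcal{B}_\mathcal{A}=\{\mathsf z^\gamma\}_{\gamma\in\mathcal{M}}$ is the monomial basis of $\mathcal{A}$, and $\langle\cdot,\cdot\rangle$ is the canonical pairing on $\mathcal{A}$ relative to $\mathcal{B}_\mathcal{A}$ (so $\langle\mathsf z^\gamma,\mathsf z^\beta\rangle=1$ if $\gamma=\beta$ and $0$ otherwise).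
   Context: Let $\mathbb{N}=\{0,1,\dots\}$, $d\ge1$, $\mathbb{N}^d_*=\mathbb{N}^d\setminus\{\mathbf 0\}$, $\mathbf e_i$ the canonical basis vectors, $|\mathbf n|=n_1+\dots+n_d$, and fix $\alpha\in(0,1)$. $\mathcal{A}:=\mathbb{R}[\mathsf z_k,\mathsf z_{\mathbf n}]_{k\in\mathbb{N},\mathbf n\in\mathbb{N}^d_*}$ is the polynomial algebra with unit $\mathbf 1$. $\mathcal{M}$ is the set of finitely supported $\gamma:\mathbb{N}\sqcup\mathbb{N}^d_*\to\mathbb{N}$, $\mathsf z^\gamma:=\prod_i\mathsf z_i^{\gamma_i}$, and $|\gamma|:=\alpha\sum_{k\ge0}\gamma_k+\sum_{\mathbf n\ne\mathbf 0}|\mathbf n|\gamma_{\mathbf n}$. Derivations of $\mathcal{A}$: $D^{(\mathbf 0)}:=\sum_{k\ge0}(k+1)\mathsf z_{k+1}\partial_{\mathsf z_k}$, $D^{(\mathbf n)}:=\partial_{\mathsf z_{\mathbf n}}$ for $\mathbf n\in\mathbb{N}^d_*$, $\partial_i:=\sum_{\mathbf n\in\mathbb{N}^d}(n_i+1)\mathsf z_{\mathbf n+\mathbf e_i}D^{(\mathbf n)}$ for $1\le i\le d$; $\mathcal{D}$ is their linear span (they form a basis of $\mathcal{D}$). $L\subset\mathcal{A}\otimes\mathcal{D}$ is the subspace with linear basis $$\mathcal{B}_L:=\{\mathbf 1\otimes\partial_i\}_{1\le i\le d}\cup\{\mathsf z^\gamma\otimes D^{(\mathbf n)}:\gamma\in\mathcal{M},\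 \mathbf n\in\mathbb{N}^d,\ |\gamma|>|\mathbf n|\}.$$ $\mathsf{Sym}(L)$ is the symmetric algebra, with monomial basis $\overline{\mathcal{B}}_{\mathsf{Sym}(L)}$ consisting of the unit $\mathbb 1$ and the monomials $x_1^{m_1}\cdots x_k^{m_k}$ with $k,m_i\ge1$ and distinct $x_i\in\mathcal{B}_L$. The bilinear operation $\diamond$ on $\mathcal{D}$ is given on the basis by $D^{(\mathbf n)}\diamond D^{(\mathbf n')}=0$, $\partial_i\diamond\partial_j=0$, $D^{(\mathbf n)}\diamond\partial_i=0$, $\partial_i\diamond D^{(\mathbf n)}=-n_iD^{(\mathbf n-\mathbf e_i)}$ (zero if $n_i=0$). The linear map $\Psi_\diamond$ from the tensor algebra of $\mathcal{D}$ to $\mathrm{End}(\mathcal{A})$ is defined by $\Psi_\diamond[\emptyset]=\mathrm{id}$, $\Psi_\diamond[D]=D$ and $$\Psi_\diamond[D_0D_1\cdots D_n]:=D_0\circ\Psi_\diamond[D_1\cdots D_n]-\sum_{i=1}^n\Psi_\diamond[D_1\cdots(D_0\diamond D_i)\cdots D_n].$$ The representation $\bar\rho_\blacktriangleright:\mathsf{Sym}(L)\to\mathrm{End}(\mathcal{A})$ is given by $$\bar\rho_\blacktriangleright\big((a_1\otimes D_1)\cdots(a_n\otimes D_n)\big)(b)=a_1\cdots a_n\,\Psi_\diamond[D_1\cdots D_n](b),\qquad\bar\rho_\blacktriangleright(\mathbb 1)=\mathrm{id};$$ it is well defined on $\mathsf{Sym}(L)$, since $[\cdot,\cdot]_\diamond=[\cdot,\cdot]_\circ$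 on $\mathcal{D}$. *)

theory Defs
  imports
    "HOL-Library.Poly_Mapping"
    "HOL-Library.Multiset"
    "HOL-Analysis.Finite_Cartesian_Product"
begin

section \<open>Finitely supported functions as real vector spaces\<close>

instantiation poly_mapping :: (type, real_vector) real_vector
begin

lift_definition scaleR_poly_mapping :: "real \<Rightarrow> ('a \<Rightarrow>\<^sub>0 'b) \<Rightarrow> ('a \<Rightarrow>\<^sub>0 'b)"
  is "\<lambda>c f k. c *\<^sub>R f k"
  by (rule finite_subset) auto

instance
  by standard (transfer; simp add: fun_eq_iff scaleR_add_left scaleR_add_right)+

end

text \<open>The linear map on the free vector space \<^typ>\<open>'k \<Rightarrow>\<^sub>0 real\<close> with prescribed values on the basis.\<close>

definition lin_ext :: "('k \<Rightarrow> 'v::real_vector) \<Rightarrow> ('k \<Rightarrow>\<^sub>0 real) \<Rightarrow> 'v" where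
  "lin_ext f p = (\<Sum>k\<in>Poly_Mapping.keys p. Poly_Mapping.lookup p k *\<^sub>R f k)"

section \<open>The polynomial algebra\<close>

text \<open>\<open>\<nat>\<^sup>d\<close> is \<^typ>\<open>nat ^ 'd\<close> with canonical basis vectors \<^term>\<open>axis i (1::nat)\<close>.\<close>

definition deg :: "nat ^ 'd \<Rightarrow> nat" where
  "deg n = (\<Sum>i\<in>UNIV. n $ i)"

typedef 'd pos_index = "{n :: nat ^ 'd::finite. n \<noteq> 0}"
  morphisms vec_of pos_of
proof
  show "axis (undefined::'d) 1 \<in> {n :: nat ^ 'd. n \<noteq> 0}" by (simp add: axis_eq_0_iff)
qed

text \<open>\<open>\<nat> \<squnion> \<nat>\<^sup>d\<^sub>*\<close>, the index set of the variables of the polynomial algebra.\<close>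

datatype 'd zvar = ZN nat | ZV "'d pos_index"

type_synonym 'd mon = "'d zvar \<Rightarrow>\<^sub>0 nat"
type_synonym 'd alg = "'d mon \<Rightarrow>\<^sub>0 real"

definition zpow :: "'d::finite mon \<Rightarrow> 'd alg" where
  "zpow \<gamma> = Poly_Mapping.single \<gamma> 1"

definition A_basis :: "'d::finite alg set" where
  "A_basis = range zpow"

definition zN :: "nat \<Rightarrow> 'd::finite alg" where
  "zN k = zpow (Poly_Mapping.single (ZN k) 1)"

text \<open>Only meaningful for \<^prop>\<open>n \<noteq> 0\<close>.\<close>

definition zV :: "nat ^ 'd::finite \<Rightarrow> 'd alg" where
  "zV n = zpow (Poly_Mapping.single (ZV (pos_of n)) 1)"

text \<open>The degree \<open>|\<gamma>|\<close>; both sums are finite because \<open>\<gamma>\<close> has finite support.\<close>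

definition homog :: "real \<Rightarrow> 'd::finite mon \<Rightarrow> real" where
  "homog \<alpha> \<gamma> = \<alpha> * real (Sum_any (\<lambda>k. Poly_Mapping.lookup \<gamma> (ZN k)))
             + real (Sum_any (\<lambda>v. deg (vec_of v) * Poly_Mapping.lookup \<gamma> (ZV v)))"

definition pairing :: "'d::finite alg \<Rightarrow> 'd alg \<Rightarrow> real" where
  "pairing a b = Sum_any (\<lambda>\<gamma>. Poly_Mapping.lookup a \<gamma> * Poly_Mapping.lookup b \<gamma>)"

section \<open>The derivations\<close>

definition pd :: "'d::finite zvar \<Rightarrow> 'd alg \<Rightarrow> 'd alg" where
  "pd v = lin_ext (\<lambda>\<gamma>. real (Poly_Mapping.lookup \<gamma> v) *\<^sub>R zpow (\<gamma> - Poly_Mapping.single v 1))"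

text \<open>The sums below run over infinite index sets, but on each polynomial only finitely many
  summands are nonzero.\<close>

definition D_op :: "nat ^ 'd::finite \<Rightarrow> 'd alg \<Rightarrow> 'd alg" where
  "D_op n a = (if n = 0 then Sum_any (\<lambda>k. real (k + 1) *\<^sub>R (zN (k + 1) * pd (ZN k) a))
               else pd (ZV (pos_of n)) a)"

definition partial_op :: "'d::finite \<Rightarrow> 'd alg \<Rightarrow> 'd alg" where
  "partial_op i a = Sum_any (\<lambda>n. real (n $ i + 1) *\<^sub>R (zV (n + axis i 1) * D_op n a))"

text \<open>\<open>\<D>\<close> is represented by coordinates with respect to its basis consisting of the \<open>D\<^sup>(\<^sup>n\<^sup>)\<close>
  and the \<open>\<partial>\<^sub>i\<close>; \<open>der_op\<close> is the inclusion into the endomorphisms of the algebra, and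
  \<open>inj_der_op\<close> below states that it is injective.\<close>

datatype 'd gen = DG "nat ^ 'd::finite" | PG 'd

type_synonym 'd der = "'d gen \<Rightarrow>\<^sub>0 real"

fun gen_op :: "'d::finite gen \<Rightarrow> 'd alg \<Rightarrow> 'd alg" where
  "gen_op (DG n) = D_op n"
| "gen_op (PG i) = partial_op i"

definition der_op :: "'d::finite der \<Rightarrow> 'd alg \<Rightarrow> 'd alg" where
  "der_op X a = lin_ext (\<lambda>g. gen_op g a) X"

definition bas :: "'d::finite gen \<Rightarrow> 'd der" where
  "bas g = Poly_Mapping.single g 1"

text \<open>If \<^prop>\<open>n $ i = 0\<close> then the coefficient in the first equation vanishes, so the truncated
  subtraction is harmless.\<close>

fun gen_diamond :: "'d::finite gen \<Rightarrow> 'd gen \<Rightarrow> 'd der" where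
  "gen_diamond (PG i) (DG n) = - real (n $ i) *\<^sub>R bas (DG (n - axis i 1))"
| "gen_diamond _ _ = 0"

definition diamond :: "'d::finite der \<Rightarrow> 'd der \<Rightarrow> 'd der" (infixl \<open>\<diamondop>\<close> 70) where
  "X \<diamondop> Y = lin_ext (\<lambda>g. lin_ext (gen_diamond g) Y) X"

text \<open>A linear map on the tensor algebra of \<open>\<D>\<close> is given by its values on words in \<open>\<D>\<close>, multilinear
  for each length (see \<open>linear_Psi_slot\<close>).  The value on a word of length one is an instance of the
  second equation.\<close>

function Psi :: "'d::finite der list \<Rightarrow> 'd alg \<Rightarrow> 'd alg" where
  "Psi [] b = b"
| "Psi (X # Xs) b = der_op X (Psi Xs b) - (\<Sum>i<length Xs. Psi (Xs[i := X \<diamondop> Xs ! i]) b)"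
  by pat_completeness auto
termination by (relation "measure (\<lambda>(Xs, b). length Xs)") auto

section \<open>The space L, its symmetric algebra, and the representation\<close>

text \<open>The tensor product of \<^typ>\<open>'d alg\<close> and \<^typ>\<open>'d der\<close> is the free vector space on the pairs
  of basis elements.\<close>

type_synonym 'd ten = "('d mon \<times> 'd gen) \<Rightarrow>\<^sub>0 real"

definition tensor :: "'d::finite alg \<Rightarrow> 'd der \<Rightarrow> 'd ten" where
  "tensor a X = lin_ext (\<lambda>\<gamma>. lin_ext (\<lambda>g. Poly_Mapping.single (\<gamma>, g) 1) X) a"

definition L_basis :: "real \<Rightarrow> 'd::finite ten set" where
  "L_basis \<alpha> = {tensor 1 (bas (PG i)) | i. True}
             \<union> {tensor (zpow \<gamma>) (bas (DG n)) | \<gamma> n. homog \<alpha> \<gamma> > real (deg n)}"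

definition L_space :: "real \<Rightarrow> 'd::finite ten set" where
  "L_space \<alpha> = span (L_basis \<alpha>)"

text \<open>The symmetric algebra of the full tensor product is the polynomial algebra on its basis, with
  \<open>iota\<close> the inclusion of degree one; \<open>Sym(L)\<close> is the subalgebra spanned by the monomials in the
  basis of L.\<close>

type_synonym 'd sym = "(('d mon \<times> 'd gen) \<Rightarrow>\<^sub>0 nat) \<Rightarrow>\<^sub>0 real"

definition iota :: "'d::finite ten \<Rightarrow> 'd sym" where
  "iota = lin_ext (\<lambda>v. Poly_Mapping.single (Poly_Mapping.single v 1) 1)"

text \<open>The case \<open>X = {}\<close> gives the unit.\<close>

definition Sym_L_basis :: "real \<Rightarrow> 'd::finite sym set" where
  "Sym_L_basis \<alpha> = {\<Prod>x\<in>X. iota x ^ m x | X m. finite X \<and> X \<subseteq> L_basis \<alpha> \<and> (\<forall>x\<in>X. m x \<ge> 1)}"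

definition Sym_L :: "real \<Rightarrow> 'd::finite sym set" where
  "Sym_L \<alpha> = span (Sym_L_basis \<alpha>)"

definition rho_word :: "('d::finite mon \<times> 'd gen) list \<Rightarrow> 'd alg \<Rightarrow> 'd alg" where
  "rho_word vs b = prod_list (map (\<lambda>(\<gamma>, g). zpow \<gamma>) vs) * Psi (map (\<lambda>(\<gamma>, g). bas g) vs) b"

text \<open>On a monomial the factors are put in an arbitrary order.  By \<open>rho_prod\<close> the result does not
  depend on it, and the defining formula of the representation holds for all products of elementary
  tensors.\<close>

definition rho :: "'d::finite sym \<Rightarrow> 'd alg \<Rightarrow> 'd alg" where
  "rho u b = lin_ext (\<lambda>\<mu>. rho_word (SOME vs. \<forall>v. count (mset vs) v = Poly_Mapping.lookup \<mu> v) b) u"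

section \<open>Linear extension\<close>

lemma lookup_scaleR [simp]: "Poly_Mapping.lookup (c *\<^sub>R p) k = c *\<^sub>R Poly_Mapping.lookup p k"
  by transfer simp

lemma scaleR_conv_mult: "c *\<^sub>R p = Poly_Mapping.single 0 c * (p :: 'k::comm_monoid_add \<Rightarrow>\<^sub>0 real)"
  by (rule poly_mapping_eqI)
    (simp add: mult_map_scale_conv_mult[symmetric] Poly_Mapping.map.rep_eq when_def)

lemma scaleR_mult_left: "(c *\<^sub>R p) * q = c *\<^sub>R (p * q)"
  for p q :: "'k::comm_monoid_add \<Rightarrow>\<^sub>0 real"
  by (simp add: scaleR_conv_mult mult.assoc)

lemma scaleR_mult_right: "p * (c *\<^sub>R q) = c *\<^sub>R (p * q)"
  for p q :: "'k::comm_monoid_add \<Rightarrow>\<^sub>0 real"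
  by (simp add: scaleR_conv_mult ac_simps)

lemma lin_ext_superset:
  assumes "finite S" "Poly_Mapping.keys p \<subseteq> S"
  shows "lin_ext f p = (\<Sum>k\<in>S. Poly_Mapping.lookup p k *\<^sub>R f k)"
  unfolding lin_ext_def using assms
  by (intro sum.mono_neutral_left) (auto simp: in_keys_iff)

lemma linear_lin_ext: "linear (lin_ext f)"
proof (rule linearI)
  fix p q :: "'a \<Rightarrow>\<^sub>0 real" and c
  let ?S = "Poly_Mapping.keys p \<union> Poly_Mapping.keys q"
  have "lin_ext f (p + q) = (\<Sum>k\<in>?S. Poly_Mapping.lookup (p + q) k *\<^sub>R f k)"
    by (rule lin_ext_superset) (auto simp: in_keys_iff lookup_add)
  moreover have "lin_ext f p = (\<Sum>k\<in>?S. Poly_Mapping.lookup p k *\<^sub>R f k)"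
       "lin_ext f q = (\<Sum>k\<in>?S. Poly_Mapping.lookup q k *\<^sub>R f k)"
    by (rule lin_ext_superset; simp)+
  ultimately show "lin_ext f (p + q) = lin_ext f p + lin_ext f q"
    by (simp add: lookup_add scaleR_add_left sum.distrib)
  have "lin_ext f (c *\<^sub>R p) = (\<Sum>k\<in>Poly_Mapping.keys p. Poly_Mapping.lookup (c *\<^sub>R p) k *\<^sub>R f k)"
    by (rule lin_ext_superset) (auto simp: in_keys_iff)
  then show "lin_ext f (c *\<^sub>R p) = c *\<^sub>R lin_ext f p"
    by (simp add: lin_ext_def scaleR_sum_right)
qed

lemma lin_ext_single [simp]: "lin_ext f (Poly_Mapping.single k c) = c *\<^sub>R f k"
  by (subst lin_ext_superset[of "{k}"]) auto

lemma linear_lin_ext_fun: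
  assumes "\<And>k. linear (\<lambda>x. f x k)" shows "linear (\<lambda>x. lin_ext (f x) p)"
  unfolding lin_ext_def
  by (intro linear_compose_sum ballI linear_compose_scale_right assms) 

lemma lin_ext_id: "lin_ext (\<lambda>k. Poly_Mapping.single k 1) p = p"
  by (rule poly_mapping_eqI)
    (simp add: lin_ext_def lookup_sum lookup_single when_def if_distrib[of "\<lambda>x. _ * x"] 
       sum.delta in_keys_iff cong: if_cong)

lemma linear_lin_ext_comp:
  assumes "linear F" shows "F (lin_ext f p) = lin_ext (\<lambda>k. F (f k)) p"
  using assms by (simp add: lin_ext_def linear_sum linear_scale)

lemma linear_eqI_basis:
  fixes F G :: "('k \<Rightarrow>\<^sub>0 real) \<Rightarrow> 'v::real_vector"
  assumes "linear F" "linear G" "\<And>k. F (Poly_Mapping.single k 1) = G (Poly_Mapping.single k 1)"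
  shows "F p = G p"
proof -
  have "F (lin_ext (\<lambda>k. Poly_Mapping.single k 1) p) = G (lin_ext (\<lambda>k. Poly_Mapping.single k 1) p)"
    by (simp only: linear_lin_ext_comp[OF assms(1)] linear_lin_ext_comp[OF assms(2)] assms(3))
  then show ?thesis by (simp add: lin_ext_id)
qed

section \<open>Derivations and their commutators\<close>

definition derivation :: "('d::finite alg \<Rightarrow> 'd alg) \<Rightarrow> bool" where
  "derivation d \<longleftrightarrow> linear d \<and> (\<forall>a b. d (a * b) = d a * b + a * d b)"

lemma zpow_add: "zpow (\<gamma> + \<delta>) = zpow \<gamma> * zpow \<delta>" by (simp add: zpow_def mult_single)

lemma zpow_0 [simp]: "zpow 0 = 1" by (simp add: zpow_def)

lemma linear_mult_left: "linear (\<lambda>a. a * b)" for b :: "'k::comm_monoid_add \<Rightarrow>\<^sub>0 real"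
  by (rule linearI) (simp_all only: distrib_right scaleR_mult_left)
lemma linear_mult_right: "linear (\<lambda>a. b * a)" for b :: "'k::comm_monoid_add \<Rightarrow>\<^sub>0 real"
  by (rule linearI) (simp_all only: distrib_left scaleR_mult_right)

lemma linear_pd: "linear (pd v)" unfolding pd_def by (rule linear_lin_ext)

lemma pd_zpow: "pd v (zpow \<gamma>) = real (Poly_Mapping.lookup \<gamma> v) *\<^sub>R zpow (\<gamma> - Poly_Mapping.single v 1)"
  by (simp add: pd_def zpow_def[of \<gamma>])

lemma mon_minus_add:
  fixes \<gamma> \<delta> :: "'d::finite mon"
  assumes "Poly_Mapping.lookup \<gamma> v \<noteq> 0"
  shows "\<gamma> + \<delta> - Poly_Mapping.single v 1 = (\<gamma> - Poly_Mapping.single v 1) + \<delta>"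
  using assms by (intro poly_mapping_eqI) (auto simp: lookup_add lookup_minus lookup_single when_def)

lemma pd_Leibniz_mon: "pd v (zpow \<gamma> * zpow \<delta>) = pd v (zpow \<gamma>) * zpow \<delta> + zpow \<gamma> * pd v (zpow \<delta>)"
proof -
  have 1: "real (Poly_Mapping.lookup \<gamma> v) *\<^sub>R zpow (\<gamma> + \<delta> - Poly_Mapping.single v 1)
     = real (Poly_Mapping.lookup \<gamma> v) *\<^sub>R (zpow (\<gamma> - Poly_Mapping.single v 1) * zpow \<delta>)"
   for \<gamma> \<delta> :: "'a mon"
    by (cases "Poly_Mapping.lookup \<gamma> v = 0") (simp_all add: mon_minus_add[of \<gamma> v \<delta>, simplified] zpow_add[symmetric])
  have "pd v (zpow \<gamma> * zpow \<delta>) = real (Poly_Mapping.lookup \<gamma> v) *\<^sub>R zpow (\<gamma> + \<delta> - Poly_Mapping.single v 1)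
      + real (Poly_Mapping.lookup \<delta> v) *\<^sub>R zpow (\<delta> + \<gamma> - Poly_Mapping.single v 1)"
    unfolding add.commute[of \<delta> \<gamma>] zpow_add[symmetric] pd_zpow lookup_add of_nat_add by (rule scaleR_add_left)
  then show ?thesis
    by (simp only: 1 pd_zpow scaleR_mult_left scaleR_mult_right mult.commute)
qed

lemma derivation_pd: "derivation (pd v)"
  unfolding derivation_def
proof (intro conjI allI linear_pd)
  fix a b
  note lin = linear_compose_add linear_compose[OF linear_mult_right linear_pd, unfolded o_def]
    linear_compose[OF linear_pd linear_mult_right, unfolded o_def] linear_mult_right
    linear_compose[OF linear_mult_left linear_pd, unfolded o_def]
    linear_compose[OF linear_pd linear_mult_left, unfolded o_def] linear_mult_left
  have *: "pd v (zpow \<gamma> * b) = pd v (zpow \<gamma>) * b + zpow \<gamma> * pd v b" for \<gamma>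
    by (rule linear_eqI_basis[of "\<lambda>b. pd v (zpow \<gamma> * b)" "\<lambda>b. pd v (zpow \<gamma>) * b + zpow \<gamma> * pd v b"])
     (rule lin | simp only: zpow_def[symmetric] pd_Leibniz_mon)+
  show "pd v (a * b) = pd v a * b + a * pd v b"
    by (rule linear_eqI_basis[of "\<lambda>a. pd v (a * b)" "\<lambda>a. pd v a * b + a * pd v b"])
     (rule lin | simp only: zpow_def[symmetric] *)+
qed

lemma derivationD:
  assumes "derivation d"
  shows "linear d" "d (a * b) = d a * b + a * d b" "d 1 = 0"
proof -
  show "linear d" "d (a * b) = d a * b + a * d b" using assms by (auto simp: derivation_def)
  have "d (1 * 1) = d 1 * 1 + 1 * d 1" using assms unfolding derivation_def by blast
  then show "d 1 = 0" by simp
qed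

definition gz :: "'d::finite zvar \<Rightarrow> 'd alg" where "gz v = zpow (Poly_Mapping.single v 1)"

lemma derivation_0I:
  assumes "derivation d" "\<And>v. d (gz v) = 0"
  shows "d a = 0"
proof -
  have "d (zpow \<gamma>) = 0" for \<gamma> :: "'a mon"
  proof (induction "Sum_any (Poly_Mapping.lookup \<gamma>)" arbitrary: \<gamma>)
    case 0
    then have "Poly_Mapping.lookup \<gamma> = (\<lambda>_. 0)" by simp
    then have "\<gamma> = 0" by (intro poly_mapping_eqI) simp
    then show ?case using derivationD(3)[OF assms(1)] by simp
  next
    case (Suc n)
    then have "\<gamma> \<noteq> 0" by auto
    then obtain v where v: "Poly_Mapping.lookup \<gamma> v \<noteq> 0" by (metis poly_mapping_eqI lookup_zero)
    define \<delta> where "\<delta> = \<gamma> - Poly_Mapping.single v 1"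
    have \<gamma>: "\<gamma> = Poly_Mapping.single v 1 + \<delta>"
      unfolding \<delta>_def using v by (intro poly_mapping_eqI) (auto simp: lookup_add lookup_minus lookup_single when_def)
    have "Sum_any (Poly_Mapping.lookup \<gamma>) = Sum_any (Poly_Mapping.lookup (Poly_Mapping.single v (1::nat))) + Sum_any (Poly_Mapping.lookup \<delta>)"
      unfolding \<gamma> lookup_add by (rule Sum_any.distrib) simp_all
    also have "Sum_any (Poly_Mapping.lookup (Poly_Mapping.single v (1::nat))) = 1"
      by (simp add: lookup_single when_def)
    finally have "n = Sum_any (Poly_Mapping.lookup \<delta>)" using Suc(2) by simp
    then have "d (zpow \<delta>) = 0" by (rule Suc(1))
    then show ?case unfolding \<gamma> zpow_add derivationD(2)[OF assms(1)] 
      using assms(2)[of v] by (simp add: gz_def)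
  qed
  then show ?thesis using linear_eqI_basis[of d "\<lambda>_. 0" a] derivationD(1)[OF assms(1)]
    by (simp add: zpow_def linear_zero)
qed

lemma finite_pd: "finite {v. pd v a \<noteq> 0}"
proof (rule finite_subset)
  show "finite (\<Union>\<gamma>\<in>Poly_Mapping.keys a. Poly_Mapping.keys \<gamma>)" by simp
  show "{v. pd v a \<noteq> 0} \<subseteq> (\<Union>\<gamma>\<in>Poly_Mapping.keys a. Poly_Mapping.keys \<gamma>)"
  proof
    fix v assume "v \<in> {v. pd v a \<noteq> 0}"
    then have "(\<Sum>\<gamma>\<in>Poly_Mapping.keys a. Poly_Mapping.lookup a \<gamma> *\<^sub>R 
        real (Poly_Mapping.lookup \<gamma> v) *\<^sub>R zpow (\<gamma> - Poly_Mapping.single v 1)) \<noteq> 0"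
      by (simp add: pd_def lin_ext_def)
    then obtain \<gamma> where "\<gamma> \<in> Poly_Mapping.keys a" "Poly_Mapping.lookup \<gamma> v \<noteq> 0"
      by (smt (verit, best) sum.neutral of_nat_0 scaleR_zero_left scaleR_zero_right)
    then show "v \<in> (\<Union>\<gamma>\<in>Poly_Mapping.keys a. Poly_Mapping.keys \<gamma>)" by (auto simp: in_keys_iff)
  qed
qed

lemma pos_of_inj: "n \<noteq> 0 \<Longrightarrow> m \<noteq> 0 \<Longrightarrow> pos_of n = pos_of m \<longleftrightarrow> n = m"
  by (simp add: pos_of_inject)

lemma derivation_Sum_any:
  fixes d :: "'k \<Rightarrow> 'd::finite alg \<Rightarrow> 'd alg"
  assumes d: "\<And>k. derivation (d k)" and f: "\<And>a. finite {k. d k a \<noteq> 0}"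
  shows "derivation (\<lambda>a. Sum_any (\<lambda>k. c k * d k a))"
proof -
  have S: "Sum_any (\<lambda>k. c k * d k a) = (\<Sum>k\<in>S. c k * d k a)" 
    if "finite S" "{k. d k a \<noteq> 0} \<subseteq> S" for S a
    using that by (intro Sum_any.expand_superset) auto
  show ?thesis unfolding derivation_def
  proof (intro conjI allI linearI)
    fix a b
    define T where "T = {k. d k a \<noteq> 0} \<union> {k. d k b \<noteq> 0} \<union> {k. d k (a+b) \<noteq> 0} \<union> {k. d k (a*b) \<noteq> 0}"
    have fin: "finite T" unfolding T_def using f by auto
    have SS: "Sum_any (\<lambda>k. c k * d k x) = (\<Sum>k\<in>T. c k * d k x)" if "x \<in> {a, b, a + b, a * b}" for x
      using that by (intro S fin) (auto simp: T_def)
    show "Sum_any (\<lambda>k. c k * d k (a + b)) = Sum_any (\<lambda>k. c k * d k a) + Sum_any (\<lambda>k. c k * d k b)"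
      using SS[of a] SS[of b] SS[of "a + b"]
      by (simp only: insert_iff simp_thms) (simp add: linear_add[OF derivationD(1)[OF d]] distrib_left sum.distrib)
    show "Sum_any (\<lambda>k. c k * d k (a * b)) = Sum_any (\<lambda>k. c k * d k a) * b + a * Sum_any (\<lambda>k. c k * d k b)"
    proof -
      have "(\<Sum>k\<in>T. c k * d k (a * b)) = (\<Sum>k\<in>T. c k * d k a * b + a * (c k * d k b))"
        by (intro sum.cong refl) (simp only: derivationD(2)[OF d] distrib_left mult_ac)
      also have "\<dots> = (\<Sum>k\<in>T. c k * d k a) * b + a * (\<Sum>k\<in>T. c k * d k b)"
        by (simp only: sum.distrib sum_distrib_left[of a] sum_distrib_right[of _ _ b])
      finally show ?thesis using SS[of a] SS[of b] SS[of "a * b"] by (simp only: insert_iff simp_thms)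
    qed
  next
    fix r a
    define T where "T = {k. d k a \<noteq> 0} \<union> {k. d k (r *\<^sub>R a) \<noteq> 0}"
    have fin: "finite T" unfolding T_def using f by auto
    have SS: "Sum_any (\<lambda>k. c k * d k x) = (\<Sum>k\<in>T. c k * d k x)" if "x \<in> {a, r *\<^sub>R a}" for x
      using that by (intro S fin) (auto simp: T_def)
    show "Sum_any (\<lambda>k. c k * d k (r *\<^sub>R a)) = r *\<^sub>R Sum_any (\<lambda>k. c k * d k a)"
      using SS[of a] SS[of "r *\<^sub>R a"]
      by (simp only: insert_iff simp_thms) (simp add: linear_scale[OF derivationD(1)[OF d]] scaleR_mult_right scaleR_sum_right)
  qed
qed

lemma finite_D_op: "finite {n. D_op n a \<noteq> 0}"
proof -
  have "finite {n. n \<noteq> 0 \<and> pd (ZV (pos_of n)) a \<noteq> 0}"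
  proof (rule finite_imageD[of "\<lambda>n. ZV (pos_of n)"])
    show "finite ((\<lambda>n. ZV (pos_of n)) ` {n. n \<noteq> 0 \<and> pd (ZV (pos_of n)) a \<noteq> 0})"
      by (rule finite_subset[OF _ finite_pd[of a]]) auto
  qed (auto intro!: inj_onI simp: pos_of_inj)
  then have "finite ({0} \<union> {n. n \<noteq> 0 \<and> pd (ZV (pos_of n)) a \<noteq> 0})" by simp
  then show ?thesis by (rule rev_finite_subset) (auto simp: D_op_def)
qed

lemma finite_pd_ZN: "finite {k. pd (ZN k) a \<noteq> 0}"
  by (rule finite_imageD[of ZN]) (auto intro: inj_onI finite_subset[OF _ finite_pd[of a]])

lemma derivation_D_op: "derivation (D_op n)"
proof (cases "n = 0")
  case True
  have "D_op n = (\<lambda>a. Sum_any (\<lambda>k. (real (k + 1) *\<^sub>R zN (k + 1)) * pd (ZN k) a))"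
    by (simp add: fun_eq_iff D_op_def True scaleR_mult_left)
  then show ?thesis by (simp add: derivation_Sum_any derivation_pd finite_pd_ZN)
next
  case False
  then have "D_op n = pd (ZV (pos_of n))" by (simp add: fun_eq_iff D_op_def)
  then show ?thesis by (simp add: derivation_pd)
qed

lemma derivation_partial_op: "derivation (partial_op i)"
proof -
  have "partial_op i = (\<lambda>a. Sum_any (\<lambda>n. (real (n $ i + 1) *\<^sub>R zV (n + axis i 1)) * D_op n a))"
    by (simp add: fun_eq_iff partial_op_def scaleR_mult_left)
  then show ?thesis by (simp add: derivation_Sum_any derivation_D_op finite_D_op)
qed

lemma pd_gz: "pd v (gz w) = (if v = w then 1 else 0)"
  unfolding gz_def pd_zpow by (auto simp: lookup_single when_def)

lemma zN_gz: "zN k = gz (ZN k)" by (simp add: zN_def gz_def)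
lemma zV_gz: "zV n = gz (ZV (pos_of n))" by (simp add: zV_def gz_def)

lemma zvar_cases_gz: obtains k where "gz v = zN k" | n where "n \<noteq> 0" "gz v = zV n"
proof (cases v)
  case (ZN k) then show thesis using that by (simp add: zN_gz)
next
  case (ZV p)
  then show thesis using that(2)[of "vec_of p"] vec_of[of p] by (simp add: zV_gz vec_of_inverse)
qed

lemma D_op_zN: "D_op n (zN k) = (if n = 0 then real (k+1) *\<^sub>R zN (k+1) else 0)"
proof -
  have "Sum_any (\<lambda>j. real (j + 1) *\<^sub>R (zN (j + 1) * pd (ZN j) (zN k :: 'a alg)))
     = Sum_any (\<lambda>j. if j = k then real (j + 1) *\<^sub>R zN (j + 1) else 0)"
    by (rule Sum_any.cong) (auto simp: zN_gz pd_gz)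
  then show ?thesis by (simp add: D_op_def) (simp add: zN_gz pd_gz)
qed

lemma D_op_zV: "m \<noteq> 0 \<Longrightarrow> D_op n (zV m) = (if n = m then 1 else 0)"
  by (auto simp: D_op_def zV_gz zN_gz pd_gz pos_of_inj)

lemma partial_op_zN: "partial_op i (zN k) = real (k+1) *\<^sub>R (zV (axis i 1) * zN (k+1))"
proof -
  have "partial_op i (zN k) = Sum_any (\<lambda>n::nat ^ 'a. if n = 0 then real (k+1) *\<^sub>R (zV (axis i 1) * zN (k+1)) else 0)"
    unfolding partial_op_def by (rule Sum_any.cong) (auto simp: D_op_zN scaleR_mult_right)
  then show ?thesis by simp
qed

lemma partial_op_zV: "m \<noteq> 0 \<Longrightarrow> partial_op i (zV m) = real (m $ i + 1) *\<^sub>R zV (m + axis i 1)"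
proof -
  assume m: "m \<noteq> 0"
  have "partial_op i (zV m) = Sum_any (\<lambda>n. if n = m then real (n $ i+1) *\<^sub>R zV (n + axis i 1) else 0)"
    unfolding partial_op_def by (rule Sum_any.cong) (auto simp: D_op_zV m)
  then show ?thesis by simp
qed

lemma derivation_commutator:
  assumes "derivation d" "derivation e"
  shows "derivation (\<lambda>a. d (e a) - e (d a))"
  unfolding derivation_def
  using assms[THEN derivationD(1)] assms[THEN derivationD(2)]
  by (auto intro!: linearI simp: linear_add linear_scale scaleR_diff_right algebra_simps)

lemma derivation_add:
  assumes "derivation d" "derivation e"
  shows "derivation (\<lambda>a. d a + e a)"
  unfolding derivation_def
  using assms[THEN derivationD(1)] assms[THEN derivationD(2)]
  by (auto intro!: linearI simp: linear_add linear_scale scaleR_add_right algebra_simps)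

lemma derivation_scaleR:
  assumes "derivation d"
  shows "derivation (\<lambda>a. c *\<^sub>R d a)"
  unfolding derivation_def
  using assms[THEN derivationD(1)] assms[THEN derivationD(2)]
  by (auto intro!: linearI simp: linear_add linear_scale scaleR_add_right scaleR_mult_left scaleR_mult_right)

lemma derivation_eqI:
  assumes "derivation d" "derivation e" "\<And>k. d (zN k) = e (zN k)" "\<And>n. n \<noteq> 0 \<Longrightarrow> d (zV n) = e (zV n)"
  shows "d a = e a"
proof -
  have "derivation (\<lambda>a. d a + (-1) *\<^sub>R e a)" by (intro derivation_add derivation_scaleR assms)
  moreover have "d (gz v) + (-1) *\<^sub>R e (gz v) = 0" for v
    by (rule zvar_cases_gz[of v]) (simp_all add: assms)
  ultimately have "d a + (-1) *\<^sub>R e a = 0" by (rule derivation_0I)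
  then show ?thesis by simp
qed

lemma axis_neq_0 [simp]: "axis i (1::nat) \<noteq> 0" by (simp add: axis_eq_0_iff)
lemma plus_axis_neq_0 [simp]: "n + axis i (1::nat) \<noteq> 0"
  by (auto simp: vec_eq_iff intro!: exI[of _ i])

lemma axis_nth_if: "axis i x $ j = (if j = i then x else 0)" by (simp add: axis_def)

declare plus_axis_neq_0[unfolded One_nat_def, simp]

lemma D_op_commute: "D_op n (D_op m a) = D_op m (D_op n a)"
proof -
  have L: "D_op n 1 = 0" "D_op n (c *\<^sub>R a) = c *\<^sub>R D_op n a" "D_op n 0 = 0" for n :: "nat ^ 'a" and c a
    using derivationD[OF derivation_D_op[of n]] by (auto simp: linear_scale linear_0)
  have "D_op n (D_op m a) - D_op m (D_op n a) = 0 *\<^sub>R D_op n a"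
    by (rule derivation_eqI[of "\<lambda>a. D_op n (D_op m a) - D_op m (D_op n a)" "\<lambda>a. 0 *\<^sub>R D_op n a"])
     (rule derivation_commutator derivation_scaleR derivation_D_op | simp add: D_op_zN D_op_zV L)+
  then show ?thesis by simp
qed

lemma partial_op_D_op:
  "partial_op i (D_op n a) - D_op n (partial_op i a) = (- real (n $ i)) *\<^sub>R D_op (n - axis i 1) a"
proof -
  have L: "D_op n 1 = 0" "D_op n (c *\<^sub>R a) = c *\<^sub>R D_op n a" "D_op n 0 = 0" "D_op n (a + b) = D_op n a + D_op n b"
     "D_op n (a * b) = D_op n a * b + a * D_op n b" for n :: "nat ^ 'a" and c a b
    using derivationD[OF derivation_D_op[of n]] by (auto simp: linear_scale linear_0 linear_add)
  have M: "partial_op i 1 = 0" "partial_op i (c *\<^sub>R a) = c *\<^sub>R partial_op i a" "partial_op i 0 = 0" "partial_op i (a + b) = partial_op i a + partial_op i b" for c a b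
    using derivationD[OF derivation_partial_op[of i]] by (auto simp: linear_scale linear_0 linear_add)
  have E: "m - axis i 1 = 0 \<longleftrightarrow> m = axis i 1" if "m $ i \<noteq> 0" for m :: "nat ^ 'a"
    using that by (auto simp: vec_eq_iff axis_def split: if_splits) 
  have F: "n - axis i 1 = m \<longleftrightarrow> n = m + axis i 1" if "n $ i \<noteq> 0" for n m :: "nat ^ 'a"
    using that by (auto simp: vec_eq_iff axis_def split: if_splits) 
  have Z: "(0::nat ^ 'a) - axis i 1 = 0" by (simp add: vec_eq_iff)
  show ?thesis
  proof (rule derivation_eqI[of "\<lambda>a. partial_op i (D_op n a) - D_op n (partial_op i a)" "\<lambda>a. (- real (n $ i)) *\<^sub>R D_op (n - axis i 1) a"])
    fix k
    show "partial_op i (D_op n (zN k)) - D_op n (partial_op i (zN k)) = - real (n $ i) *\<^sub>R D_op (n - axis i 1) (zN k)"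
      by (cases "n $ i = 0"; cases "n = 0") (auto simp: D_op_zN D_op_zV L M partial_op_zN E[unfolded One_nat_def] scaleR_mult_right algebra_simps)
  next
    fix m :: "nat ^ 'a" assume "m \<noteq> 0"
    then show "partial_op i (D_op n (zV m)) - D_op n (partial_op i (zV m)) = - real (n $ i) *\<^sub>R D_op (n - axis i 1) (zV m)"
      by (cases "n $ i = 0") (auto simp: D_op_zN D_op_zV L M partial_op_zV F[unfolded One_nat_def])
  qed (intro derivation_commutator derivation_scaleR derivation_D_op derivation_partial_op)+
qed

lemma partial_op_commute: "partial_op i (partial_op j a) = partial_op j (partial_op i a)"
proof -
  have M: "partial_op i 1 = 0" "partial_op i (c *\<^sub>R a) = c *\<^sub>R partial_op i a" "partial_op i 0 = 0" "partial_op i (a + b) = partial_op i a + partial_op i b"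
    "partial_op i (a * b) = partial_op i a * b + a * partial_op i b" for i :: 'a and c a b
    using derivationD[OF derivation_partial_op[of i]] by (auto simp: linear_scale linear_0 linear_add)
  have A: "n + axis i 1 + axis j 1 = n + axis j 1 + axis i (1::nat)" for n :: "nat ^ 'a" by (simp add: ac_simps)
  have "partial_op i (partial_op j a) - partial_op j (partial_op i a) = 0 *\<^sub>R partial_op j a"
  proof (rule derivation_eqI[of "\<lambda>a. partial_op i (partial_op j a) - partial_op j (partial_op i a)" "\<lambda>a. 0 *\<^sub>R partial_op j a"])
    fix k
    show "partial_op i (partial_op j (zN k)) - partial_op j (partial_op i (zN k)) = 0 *\<^sub>R partial_op j (zN k)"
      by (cases "i = j") (simp_all add: M partial_op_zN partial_op_zV scaleR_mult_right scaleR_mult_left ac_simps, simp add: axis_def add.commute)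
  next
    fix m :: "nat ^ 'a" assume "m \<noteq> 0"
    then show "partial_op i (partial_op j (zV m)) - partial_op j (partial_op i (zV m)) = 0 *\<^sub>R partial_op j (zV m)"
      by (cases "i = j") (simp_all add: M partial_op_zV A[of m, unfolded One_nat_def] axis_nth_if mult.commute)
  qed (intro derivation_commutator derivation_scaleR derivation_partial_op)+
  then show ?thesis by simp
qed

section \<open>The operation on the space of derivations\<close>

lemma linear_gen_op: "linear (gen_op g)"
  by (cases g) (simp_all add: derivationD(1)[OF derivation_D_op] derivationD(1)[OF derivation_partial_op])

lemma linear_der_op: "linear (der_op X)"
proof -
  have "linear (\<lambda>a. lin_ext (\<lambda>g. gen_op g a) X)" by (rule linear_lin_ext_fun) (rule linear_gen_op)
  then show ?thesis by (simp add: der_op_def[abs_def])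
qed

lemma linear_der_op_left: "linear (\<lambda>X. der_op X a)"
  unfolding der_op_def by (rule linear_lin_ext)

lemma der_op_bas [simp]: "der_op (bas g) = gen_op g"
  by (simp add: der_op_def bas_def fun_eq_iff)

lemma linear_diamond_left: "linear (\<lambda>X. X \<diamondop> Y)"
  unfolding diamond_def by (rule linear_lin_ext)

lemma linear_diamond_right: "linear (\<lambda>Y. X \<diamondop> Y)"
  unfolding diamond_def by (rule linear_lin_ext_fun) (rule linear_lin_ext)

lemma diamond_bas [simp]: "bas g \<diamondop> bas h = gen_diamond g h"
  by (simp add: diamond_def bas_def)

lemma der_eqI:
  assumes "linear F" "linear G" "\<And>g. F (bas g) = G (bas g)"
  shows "F X = G X"
  using assms(1,2) by (rule linear_eqI_basis) (use assms(3) in \<open>simp add: bas_def\<close>)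

lemmas linear_intros = linear_compose_sub linear_compose_add
  linear_compose[OF _ linear_der_op, unfolded o_def]
  linear_compose[OF _ linear_der_op_left, unfolded o_def]
  linear_compose[OF _ linear_diamond_left, unfolded o_def]
  linear_compose[OF _ linear_diamond_right, unfolded o_def]
  linear_ident

lemma gen_op_commutator:
  "gen_op g (gen_op h a) - gen_op h (gen_op g a) = der_op (gen_diamond g h - gen_diamond h g) a"
proof -
  note L = linear_diff[OF linear_der_op_left] linear_scale[OF linear_der_op_left] 
     linear_0[OF linear_der_op_left] linear_neg[OF linear_der_op_left]
  show ?thesis
  proof (cases g; cases h)
    fix n m assume "g = DG n" "h = DG m"
    then show ?thesis by (simp add: L D_op_commute[of n m])
  next
    fix n i assume "g = DG n" "h = PG i"
    then show ?thesis using partial_op_D_op[of i n a]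
      by (simp add: L) (simp add: algebra_simps)
  next
    fix n i assume "h = DG n" "g = PG i"
    then show ?thesis using partial_op_D_op[of i n a]
      by (simp add: L) 
  next
    fix i j assume "g = PG i" "h = PG j"
    then show ?thesis by (simp add: L partial_op_commute[of i j])
  qed
qed

lemma der_op_commutator:
  "der_op X (der_op Y a) - der_op Y (der_op X a) = der_op (X \<diamondop> Y) a - der_op (Y \<diamondop> X) a"
proof -
  have 1: "der_op (bas g) (der_op Y a) - der_op Y (der_op (bas g) a) = der_op (bas g \<diamondop> Y) a - der_op (Y \<diamondop> bas g) a" for g
    by (rule der_eqI[of "\<lambda>Y. der_op (bas g) (der_op Y a) - der_op Y (der_op (bas g) a)" "\<lambda>Y. der_op (bas g \<diamondop> Y) a - der_op (Y \<diamondop> bas g) a"])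
       ((rule linear_intros)+, simp add: gen_op_commutator linear_diff[OF linear_der_op_left])
  show ?thesis
    by (rule der_eqI[of "\<lambda>X. der_op X (der_op Y a) - der_op Y (der_op X a)" "\<lambda>X. der_op (X \<diamondop> Y) a - der_op (Y \<diamondop> X) a"])
      ((rule linear_intros)+, rule 1)
qed

lemma gen_diamond_flat:
  "bas g \<diamondop> (bas h \<diamondop> bas k) - bas h \<diamondop> (bas g \<diamondop> bas k) = (bas g \<diamondop> bas h) \<diamondop> bas k - (bas h \<diamondop> bas g) \<diamondop> bas k"
proof -
  note L = linear_scale[OF linear_diamond_left] linear_scale[OF linear_diamond_right] linear_neg[OF linear_diamond_left] linear_neg[OF linear_diamond_right]
    linear_0[OF linear_diamond_left] linear_0[OF linear_diamond_right]
  have V: "n - axis i (Suc 0) - axis j (Suc 0) = n - axis j (Suc 0) - axis i (Suc 0)" for n :: "nat ^ 'a" and i j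
    by (simp add: vec_eq_iff add.commute)
  show ?thesis
    by (cases g; cases h; cases k) (auto simp: L V axis_nth_if)
qed

lemma diamond_flat:
  "X \<diamondop> (Y \<diamondop> Z) - Y \<diamondop> (X \<diamondop> Z) = (X \<diamondop> Y) \<diamondop> Z - (Y \<diamondop> X) \<diamondop> Z"
proof -
  have 1: "bas g \<diamondop> (bas h \<diamondop> Z) - bas h \<diamondop> (bas g \<diamondop> Z) = (bas g \<diamondop> bas h) \<diamondop> Z - (bas h \<diamondop> bas g) \<diamondop> Z" for g h
    by (rule der_eqI[of "\<lambda>Z. bas g \<diamondop> (bas h \<diamondop> Z) - bas h \<diamondop> (bas g \<diamondop> Z)" "\<lambda>Z. (bas g \<diamondop> bas h) \<diamondop> Z - (bas h \<diamondop> bas g) \<diamondop> Z"])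
      ((rule linear_intros)+, rule gen_diamond_flat)
  have 2: "bas g \<diamondop> (Y \<diamondop> Z) - Y \<diamondop> (bas g \<diamondop> Z) = (bas g \<diamondop> Y) \<diamondop> Z - (Y \<diamondop> bas g) \<diamondop> Z" for g
    by (rule der_eqI[of "\<lambda>Y. bas g \<diamondop> (Y \<diamondop> Z) - Y \<diamondop> (bas g \<diamondop> Z)" "\<lambda>Y. (bas g \<diamondop> Y) \<diamondop> Z - (Y \<diamondop> bas g) \<diamondop> Z"])
      ((rule linear_intros)+, rule 1)
  show ?thesis
    by (rule der_eqI[of "\<lambda>X. X \<diamondop> (Y \<diamondop> Z) - Y \<diamondop> (X \<diamondop> Z)" "\<lambda>X. (X \<diamondop> Y) \<diamondop> Z - (Y \<diamondop> X) \<diamondop> Z"])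
      ((rule linear_intros)+, rule 2)
qed

lemma lookup_der_op:
  assumes "\<And>g. Poly_Mapping.lookup (gen_op g a) \<mu> = (if g = g0 then c else 0)"
  shows "Poly_Mapping.lookup (der_op X a) \<mu> = Poly_Mapping.lookup X g0 * c"
proof -
  have "Poly_Mapping.lookup (der_op X a) \<mu> = (\<Sum>g\<in>Poly_Mapping.keys X. if g = g0 then Poly_Mapping.lookup X g * c else 0)"
    unfolding der_op_def lin_ext_def lookup_sum by (intro sum.cong) (auto simp: assms)
  also have "\<dots> = Poly_Mapping.lookup X g0 * c" by (simp add: sum.delta in_keys_iff)
  finally show ?thesis .
qed

lemma inj_der_op: "inj der_op"
proof (rule injI, rule poly_mapping_eqI)
  fix X Y :: "'a der" and g
  assume eq: "der_op X = der_op Y"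
  have *: "Poly_Mapping.lookup X g0 = Poly_Mapping.lookup Y g0"
    if "\<And>g. Poly_Mapping.lookup (gen_op g a) \<mu> = (if g = g0 then c else 0)" "c \<noteq> 0" for g0 a \<mu> c
    using lookup_der_op[OF that(1), of X] lookup_der_op[OF that(1), of Y] that(2) eq by simp
  have one: "(1 :: 'a alg) = zpow 0" by simp
  have lz: "Poly_Mapping.lookup (zpow \<gamma>) \<delta> = (if \<gamma> = \<delta> then 1 else 0)" for \<gamma> \<delta> :: "'a mon"
    by (auto simp: zpow_def lookup_single when_def)
  have s0: "Poly_Mapping.single v (1::nat) \<noteq> 0" for v :: "'a zvar"
    by (metis lookup_single_eq lookup_zero zero_neq_one)
  have si: "Poly_Mapping.single v (1::nat) = Poly_Mapping.single w 1 \<longleftrightarrow> v = w" for v w :: "'a zvar"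
    by (metis lookup_single_eq lookup_single_not_eq zero_neq_one)
  have pi: "pos_of (n + axis i 1) = pos_of (m + axis j 1) \<longleftrightarrow> n + axis i 1 = m + axis j 1" for n m :: "nat ^ 'a" and i j
    by (simp add: pos_of_inj)
  have ss: "Poly_Mapping.single v (1::nat) + Poly_Mapping.single w 1 \<noteq> Poly_Mapping.single u 1" for v w u :: "'a zvar"
  proof
    assume "Poly_Mapping.single v (1::nat) + Poly_Mapping.single w 1 = Poly_Mapping.single u 1"
    then have "Poly_Mapping.lookup (Poly_Mapping.single v (1::nat) + Poly_Mapping.single w 1) x = (if x = u then 1 else 0)" for x
      by (simp add: lookup_single when_def)
    from this[of v] this[of w] show False by (auto simp: lookup_add lookup_single when_def split: if_splits)
  qed
  have ax: "axis i (1::nat) = axis j 1 \<longleftrightarrow> i = j" for i j :: 'a by (simp add: axis_eq_axis)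
  show "Poly_Mapping.lookup X g = Poly_Mapping.lookup Y g"
  proof (cases g)
    case (DG n)
    show ?thesis
    proof (cases "n = 0")
      case True
      show ?thesis unfolding DG True
      proof (rule *[of "zN 0" "Poly_Mapping.single (ZN 1) 1" _ 1])
        fix g :: "'a gen"
        show "Poly_Mapping.lookup (gen_op g (zN 0)) (Poly_Mapping.single (ZN 1) 1) = (if g = DG 0 then 1 else 0)"
          by (cases g) (simp_all only: gen_op.simps D_op_zN partial_op_zN, auto simp only: zN_def zV_def zpow_add[symmetric] lookup_scaleR lz ss, auto simp: lz)
      qed simp
    next
      case False
      show ?thesis unfolding DG
      proof (rule *[of "zV n" 0 _ 1])
        fix g :: "'a gen"
        show "Poly_Mapping.lookup (gen_op g (zV n)) 0 = (if g = DG n then 1 else 0)"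
          using False by (cases g) (simp_all only: gen_op.simps D_op_zV[OF False] partial_op_zV[OF False], auto simp only: one zV_def lookup_scaleR lz s0, auto simp: lz)
      qed simp
    qed
  next
    case (PG i)
    let ?n = "axis i 1 :: nat ^ 'a"
    show ?thesis unfolding PG
    proof (rule *[of "zV ?n" "Poly_Mapping.single (ZV (pos_of (?n + axis i 1))) 1" _ "real (?n $ i + 1)"])
        fix g :: "'a gen"
        show "Poly_Mapping.lookup (gen_op g (zV ?n)) (Poly_Mapping.single (ZV (pos_of (?n + axis i 1))) 1) = (if g = PG i then real (?n $ i + 1) else 0)"
          by (cases g) (simp_all only: gen_op.simps D_op_zV[OF axis_neq_0] partial_op_zV[OF axis_neq_0], auto simp only: one zV_def lookup_scaleR lz s0 si pi s0[symmetric] zvar.inject add_left_cancel ax, auto simp: lz lookup_one s0[unfolded One_nat_def])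
    qed simp
  qed
qed

section \<open>Multilinearity and symmetry; the defining formula of the representation\<close>

lemma linear_Psi: "linear (Psi Xs)"
proof (induction "length Xs" arbitrary: Xs rule: less_induct)
  case less
  show ?case
  proof (cases Xs)
    case Nil
    then have "Psi Xs = (\<lambda>b. b)" by (simp add: fun_eq_iff)
    then show ?thesis by (simp add: linear_ident)
  next
    case (Cons X Ys)
    have "linear (\<lambda>b. der_op X (Psi Ys b) - (\<Sum>i<length Ys. Psi (Ys[i := X \<diamondop> Ys ! i]) b))"
      by (intro linear_compose_sub linear_compose_sum ballI
          linear_compose[OF _ linear_der_op, unfolded o_def] less) (simp_all add: Cons)
    then show ?thesis by (simp add: Cons[symmetric] fun_eq_iff flip: Psi.simps(2))
  qed
qed

lemma linear_Psi_slot: "i < length Xs \<Longrightarrow> linear (\<lambda>X. Psi (Xs[i := X]) b)"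
proof (induction "length Xs" arbitrary: Xs i rule: less_induct)
  case less
  then obtain Y Ys where Xs: "Xs = Y # Ys" by (cases Xs) auto
  have IH: "linear (\<lambda>X. Psi (Zs[j := X]) b)" if "length Zs = length Ys" "j < length Ys" for Zs j
    using less(1)[of Zs j] that Xs by simp
  show ?case
  proof (cases i)
    case 0
    have "linear (\<lambda>X. der_op X (Psi Ys b) - (\<Sum>j<length Ys. Psi (Ys[j := X \<diamondop> Ys ! j]) b))"
      by (intro linear_compose_sub linear_compose_sum ballI linear_der_op_left
          linear_compose[OF linear_diamond_left IH, unfolded o_def]) simp_all
    then show ?thesis by (simp add: Xs 0)
  next
    case (Suc k)
    then have k: "k < length Ys" using less(2) Xs by simp
    have "linear (\<lambda>X. Psi (Ys[k := X, j := Y \<diamondop> Ys[k := X] ! j]) b)" if "j < length Ys" for j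
    proof (cases "j = k")
      case True
      then show ?thesis using k linear_compose[OF linear_diamond_right IH, unfolded o_def, of Ys k Y] by simp
    next
      case False
      then show ?thesis using k IH[of "Ys[j := Y \<diamondop> Ys ! j]" k] by (simp add: list_update_swap[of k j])
    qed
    then have "linear (\<lambda>X. der_op Y (Psi (Ys[k := X]) b) - (\<Sum>j<length Ys. Psi (Ys[k := X, j := Y \<diamondop> Ys[k := X] ! j]) b))"
      by (intro linear_compose_sub linear_compose_sum ballI
          linear_compose[OF IH linear_der_op, unfolded o_def] refl k) simp
    then show ?thesis by (simp add: Xs Suc)
  qed
qed

lemma Psi_swap_head: "Psi (X # Y # Zs) b = Psi (Y # X # Zs) b"
proof -
  let ?n = "length Zs"
  define S where "S V = (\<Sum>i<?n. Psi (Zs[i := V \<diamondop> Zs ! i]) b)" for V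
  define T where "T X Y = (\<Sum>i<?n. \<Sum>j<?n. Psi (Zs[i := X \<diamondop> Zs ! i, j := Y \<diamondop> Zs[i := X \<diamondop> Zs ! i] ! j]) b)" for X Y
  have head: "Psi (V # Zs) b = der_op V (Psi Zs b) - S V" for V by (simp add: S_def)
  have exp: "Psi (X # Y # Zs) b = der_op X (der_op Y (Psi Zs b)) - der_op X (S Y) - der_op (X \<diamondop> Y) (Psi Zs b)
      + S (X \<diamondop> Y) - der_op Y (S X) + T X Y" for X Y
  proof -
    have "Psi (X # Y # Zs) b = der_op X (Psi (Y # Zs) b) - (\<Sum>i<Suc ?n. Psi ((Y # Zs)[i := X \<diamondop> (Y # Zs) ! i]) b)"
      by simp
    also have "(\<Sum>i<Suc ?n. Psi ((Y # Zs)[i := X \<diamondop> (Y # Zs) ! i]) b)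
       = Psi ((X \<diamondop> Y) # Zs) b + (\<Sum>i<?n. Psi (Y # Zs[i := X \<diamondop> Zs ! i]) b)"
      by (simp only: sum.lessThan_Suc_shift) simp
    also have "(\<Sum>i<?n. Psi (Y # Zs[i := X \<diamondop> Zs ! i]) b) = der_op Y (S X) - T X Y"
      unfolding S_def T_def linear_sum[OF linear_der_op] by (simp add: sum_subtractf)
    finally show ?thesis unfolding head linear_diff[OF linear_der_op] by simp
  qed
  have T: "T X Y - T Y X = S (Y \<diamondop> X) - S (X \<diamondop> Y)"
  proof -
    have "T Y X = (\<Sum>i<?n. \<Sum>j<?n. Psi (Zs[j := Y \<diamondop> Zs ! j, i := X \<diamondop> Zs[j := Y \<diamondop> Zs ! j] ! i]) b)"
      unfolding T_def by (rule sum.swap)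
    then have "T X Y - T Y X = (\<Sum>i<?n. \<Sum>j<?n. Psi (Zs[i := X \<diamondop> Zs ! i, j := Y \<diamondop> Zs[i := X \<diamondop> Zs ! i] ! j]) b
      - Psi (Zs[j := Y \<diamondop> Zs ! j, i := X \<diamondop> Zs[j := Y \<diamondop> Zs ! j] ! i]) b)"
      by (simp add: T_def sum_subtractf)
    also have "\<dots> = (\<Sum>i<?n. \<Sum>j<?n. if j = i then Psi (Zs[i := Y \<diamondop> (X \<diamondop> Zs ! i)]) b - Psi (Zs[i := X \<diamondop> (Y \<diamondop> Zs ! i)]) b else 0)"
      by (intro sum.cong refl) (auto simp: list_update_swap)
    also have "\<dots> = (\<Sum>i<?n. Psi (Zs[i := Y \<diamondop> (X \<diamondop> Zs ! i)]) b - Psi (Zs[i := X \<diamondop> (Y \<diamondop> Zs ! i)]) b)"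
      by (simp add: sum.delta')
    also have "\<dots> = (\<Sum>i<?n. Psi (Zs[i := (Y \<diamondop> X) \<diamondop> Zs ! i]) b - Psi (Zs[i := (X \<diamondop> Y) \<diamondop> Zs ! i]) b)"
    proof (intro sum.cong refl)
      fix i assume "i \<in> {..<?n}"
      then have L: "linear (\<lambda>X. Psi (Zs[i := X]) b)" by (intro linear_Psi_slot) simp
      show "Psi (Zs[i := Y \<diamondop> (X \<diamondop> Zs ! i)]) b - Psi (Zs[i := X \<diamondop> (Y \<diamondop> Zs ! i)]) b
        = Psi (Zs[i := (Y \<diamondop> X) \<diamondop> Zs ! i]) b - Psi (Zs[i := (X \<diamondop> Y) \<diamondop> Zs ! i]) b"
        unfolding linear_diff[OF L, symmetric] diamond_flat ..
    qed
    also have "\<dots> = S (Y \<diamondop> X) - S (X \<diamondop> Y)" by (simp add: S_def sum_subtractf)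
    finally show ?thesis .
  qed
  show ?thesis unfolding exp using T der_op_commutator[of X Y "Psi Zs b"] by (simp add: algebra_simps) 
qed

lemma sum_nth_mset: "(\<Sum>i<length xs. f (xs ! i)) = (\<Sum>x\<in>#mset xs. f x)"
  by (metis (no_types, lifting) atLeast0LessThan mset_map sum_mset_sum_list sum_list_sum_nth length_map nth_map lessThan_iff sum.cong)

lemma Psi_perm: "mset Xs = mset Ys \<Longrightarrow> Psi Xs b = Psi Ys b"
proof (induction "length Xs" arbitrary: Xs Ys rule: less_induct)
  case less
  have cons: "Psi (X # Us) b = Psi (X # Vs) b" if len: "length Us < length Xs" and eq: "mset Us = mset Vs" for X Us Vs
  proof -
    define G where "G M = Psi (SOME Ws. mset Ws = M) b" for M
    have G: "Psi Ws b = G (mset Ws)" if "length Ws = length Us" for Ws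
      unfolding G_def using that len by (intro less(1)) (simp_all add: someI[of "\<lambda>W. mset W = mset Ws" Ws])
    have lenV: "length Vs = length Us" using eq by (metis size_mset)
    have S: "(\<Sum>i<length Ws. Psi (Ws[i := X \<diamondop> Ws ! i]) b) = (\<Sum>W\<in>#mset Ws. G (add_mset (X \<diamondop> W) (mset Ws - {#W#})))"
      if "length Ws = length Us" for Ws
    proof -
      have "(\<Sum>i<length Ws. Psi (Ws[i := X \<diamondop> Ws ! i]) b) = (\<Sum>i<length Ws. G (add_mset (X \<diamondop> Ws ! i) (mset Ws - {#Ws ! i#})))"
        by (intro sum.cong refl) (simp add: G that mset_update)
      then show ?thesis by (simp add: sum_nth_mset[of "\<lambda>W. G (add_mset (X \<diamondop> W) (mset Ws - {#W#}))" Ws])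
    qed
    show ?thesis using less(1)[OF len eq] S[of Us] S[of Vs] lenV eq by simp
  qed
  show ?case
  proof (cases Xs)
    case Nil then show ?thesis using less(2) by simp
  next
    case (Cons X Us)
    with less(2) obtain Y Vs where Ys: "Ys = Y # Vs" by (cases Ys) auto
    show ?thesis
    proof (cases "X = Y")
      case True
      then show ?thesis using cons[of Us Vs X] less(2) by (simp add: Cons Ys)
    next
      case False
      have "add_mset X (mset Us) = add_mset Y (mset Vs)" using less(2) by (simp add: Cons Ys)
      with False obtain M where M: "mset Us = add_mset Y M" "mset Vs = add_mset X M"
        by (auto simp: add_eq_conv_ex)
      obtain Ws where Ws: "mset Ws = M" by (metis ex_mset)
      have len: "length Vs = length Us" using less(2) by (metis Cons Ys length_Cons nat.inject size_mset)
      have "Psi Xs b = Psi (X # Y # Ws) b" unfolding Cons by (rule cons) (simp_all add: M Ws Cons)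
      also have "\<dots> = Psi (Y # X # Ws) b" by (rule Psi_swap_head)
      also have "\<dots> = Psi Ys b" unfolding Ys by (rule sym, rule cons) (simp_all add: M Ws Cons len)
      finally show ?thesis .
    qed
  qed
qed

lemma rho_word_perm: "mset vs = mset ws \<Longrightarrow> rho_word vs b = rho_word ws b"
  unfolding rho_word_def
  by (rule arg_cong2[of _ _ _ _ times]) (auto simp flip: prod_mset_prod_list intro!: Psi_perm)

lemma linear_rho: "linear (\<lambda>u. rho u b)" unfolding rho_def by (rule linear_lin_ext)

lemma linear_rho_right: "linear (rho u)"
proof -
  have "linear (\<lambda>b. lin_ext (\<lambda>\<mu>. rho_word (SOME vs. \<forall>v. count (mset vs) v = Poly_Mapping.lookup \<mu> v) b) u)"
    unfolding rho_word_def
    by (rule linear_lin_ext_fun) (rule linear_compose[OF linear_Psi linear_mult_right, unfolded o_def])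
  then show ?thesis by (simp add: rho_def[abs_def])
qed

lemma linear_iota: "linear iota" unfolding iota_def by (rule linear_lin_ext)

lemma linear_tensor_left: "linear (\<lambda>a. tensor a X)" unfolding tensor_def by (rule linear_lin_ext)
lemma linear_tensor_right: "linear (\<lambda>X. tensor a X)" unfolding tensor_def
  by (rule linear_lin_ext_fun) (rule linear_lin_ext)

lemma tensor_basis: "tensor (zpow \<gamma>) (bas g) = Poly_Mapping.single (\<gamma>, g) 1"
  by (simp add: tensor_def zpow_def bas_def)

lemma iota_single: "iota (Poly_Mapping.single v 1) = Poly_Mapping.single (Poly_Mapping.single v 1) 1"
  by (simp add: iota_def)

lemma rho_monom:
  assumes "\<And>v. Poly_Mapping.lookup \<mu> v = count (mset vs) v"
  shows "rho (Poly_Mapping.single \<mu> 1) b = rho_word vs b"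
proof -
  have "\<exists>ws. \<forall>v. count (mset ws) v = Poly_Mapping.lookup \<mu> v" using assms by auto
  from someI_ex[OF this] show ?thesis
    by (auto simp: rho_def assms intro!: rho_word_perm multiset_eqI)
qed

lemma prod_list_iota_basis:
  "prod_list (map (\<lambda>v. iota (Poly_Mapping.single v 1)) vs) = Poly_Mapping.single (\<Sum>v\<leftarrow>vs. Poly_Mapping.single v 1) 1"
  by (induction vs) (simp_all add: iota_single[simplified] mult_single)

lemma lookup_sum_list_single: "Poly_Mapping.lookup (\<Sum>v\<leftarrow>vs. Poly_Mapping.single v (1::nat)) w = count (mset vs) w"
  by (induction vs) (auto simp: lookup_add lookup_single when_def)

lemma Psi_slot_append: "linear (\<lambda>X. Psi (As @ X # Bs) b)"
  using linear_Psi_slot[of "length As" "As @ 0 # Bs" b] by simp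

lemma rho_prod_aux:
  "rho (prod_list (map (\<lambda>v. iota (Poly_Mapping.single v 1)) vs) * prod_list (map (\<lambda>(a, X). iota (tensor a X)) ps)) b =
    prod_list (map (\<lambda>(\<gamma>, g). zpow \<gamma>) vs) * prod_list (map fst ps) * Psi (map (\<lambda>(\<gamma>, g). bas g) vs @ map snd ps) b"
proof (induction ps arbitrary: vs)
  case Nil
  show ?case
    by (simp add: prod_list_iota_basis[simplified] rho_monom[OF lookup_sum_list_single, simplified] rho_word_def)
next
  case (Cons p ps)
  obtain a X where p: "p = (a, X)" by force
  let ?P = "prod_list (map (\<lambda>v. iota (Poly_Mapping.single v 1)) vs)"
  let ?Q = "prod_list (map (\<lambda>(a, X). iota (tensor a X)) ps)"
  let ?p = "prod_list (map (\<lambda>(\<gamma>, g). zpow \<gamma>) vs)"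
  let ?q = "prod_list (map fst ps)"
  let ?As = "map (\<lambda>(\<gamma>, g). bas g) vs"
  let ?F = "\<lambda>a X. rho (?P * (iota (tensor a X) * ?Q)) b"
  let ?G = "\<lambda>a X. ?p * (a * ?q) * Psi (?As @ X # map snd ps) b"
  note lin = linear_compose[OF _ linear_rho, unfolded o_def] linear_compose[OF _ linear_mult_left, unfolded o_def] linear_compose[OF _ linear_mult_right, unfolded o_def] linear_compose[OF _ linear_iota, unfolded o_def]
  have 0: "?F (zpow \<gamma>) (bas g) = ?G (zpow \<gamma>) (bas g)" for \<gamma> g
    using Cons[of "vs @ [(\<gamma>, g)]"] by (simp add: tensor_basis[simplified] mult.assoc)
  have 1: "?F (zpow \<gamma>) X = ?G (zpow \<gamma>) X" for \<gamma>
    by (rule der_eqI[of "?F (zpow \<gamma>)" "?G (zpow \<gamma>)"]) (rule lin linear_tensor_right Psi_slot_append 0)+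
  have "?F a X = ?G a X"
    by (rule linear_eqI_basis[of "\<lambda>a. ?F a X" "\<lambda>a. ?G a X"])
      ((rule lin linear_tensor_left linear_ident)+, simp only: zpow_def[symmetric] 1)
  then show ?case by (simp add: p)
qed

lemma rho_prod:
  "rho (prod_list (map (\<lambda>(a, X). iota (tensor a X)) ps)) b = prod_list (map fst ps) * Psi (map snd ps) b"
  using rho_prod_aux[of "[]" ps b] by simp

lemma rho_1: "rho 1 b = b" using rho_prod[of "[]" b] by simp

lemma independent_L_basis: "independent (L_basis \<alpha>)"
proof -
  have sub: "L_basis \<alpha> \<subseteq> (\<lambda>v. Poly_Mapping.single v 1) ` UNIV"
    by (auto simp: L_basis_def tensor_basis[simplified] simp flip: zpow_0)
  show ?thesis unfolding independent_explicit_module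
  proof (intro allI impI)
    fix T c and x :: "'a ten"
    assume T: "finite T" "T \<subseteq> L_basis \<alpha>" "(\<Sum>y\<in>T. c y *\<^sub>R y) = 0" "x \<in> T"
    then obtain v where v: "x = Poly_Mapping.single v 1" using sub by blast
    have "0 = Poly_Mapping.lookup (\<Sum>y\<in>T. c y *\<^sub>R y) v" using T(3) by simp
    also have "\<dots> = (\<Sum>y\<in>T. if y = x then c y else 0)"
      unfolding lookup_sum
    proof (intro sum.cong refl)
      fix y assume "y \<in> T"
      then obtain w where "y = Poly_Mapping.single w 1" using T(2) sub by blast
      then show "Poly_Mapping.lookup (c y *\<^sub>R y) v = (if y = x then c y else 0)"
        by (cases "v = w") (auto simp: v lookup_single when_def, metis lookup_single_eq lookup_single_not_eq zero_neq_one)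
    qed
    also have "\<dots> = c x" using T by (simp add: sum.delta')
    finally show "c x = 0" by simp
  qed
qed

end

theory Submission
  imports Defs
begin

text \<open>
  Give \<open>z\<^sub>k\<close> the weight \<open>\<alpha> + k\<close> and \<open>z\<^sub>n\<close> the weight \<open>|n|\<close>.  Every monomial of a polynomial loses at most
  \<open>|n|\<close> under \<open>D\<^sup>(\<^sup>n\<^sup>)\<close> and gains at least 1 under \<open>\<partial>\<^sub>i\<close>.  Since \<open>D\<^sup>(\<^sup>n\<^sup>) \<diamondop> D = 0\<close> and \<open>\<partial>\<^sub>i \<diamondop> \<partial>\<^sub>j = 0\<close>,
  writing the factors \<open>\<partial>\<^sub>i\<close> of \<open>u\<close> last turns \<open>\<Psi>\<close> into a plain composition.  If \<open>u\<close> has the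
  factors \<open>z\<^bsup>\<gamma>(j)\<^esup> \<otimes> D\<^bsup>(n(j))\<^esup>\<close> and \<open>m\<close> factors \<open>\<partial>\<^sub>i\<close>, then a nonzero coefficient of
  \<open>z\<^sup>\<beta>\<close> forces \<open>\<Sum>\<^sub>j \<gamma>(j) \<le> \<beta>\<close> and \<open>wt \<beta> \<ge> \<Sum>\<^sub>j (wt \<gamma>(j) - |n(j)|) + m + wt \<gamma>\<close>, where each
  summand of the sum is positive because \<open>wt \<gamma>(j) \<ge> |\<gamma>(j)| > |n(j)|\<close>.
  All weights are at least \<open>\<alpha>\<close>, and only finitely many monomials lie below a given weight.
\<close>

section \<open>Weights of monomials\<close>

definition wt :: "('k \<Rightarrow> real) \<Rightarrow> ('k \<Rightarrow>\<^sub>0 nat) \<Rightarrow> real" where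
  "wt w \<gamma> = (\<Sum>v\<in>Poly_Mapping.keys \<gamma>. real (Poly_Mapping.lookup \<gamma> v) * w v)"

lemma wt_superset:
  assumes "finite S" "Poly_Mapping.keys \<gamma> \<subseteq> S"
  shows "wt w \<gamma> = (\<Sum>v\<in>S. real (Poly_Mapping.lookup \<gamma> v) * w v)"
  unfolding wt_def using assms by (intro sum.mono_neutral_left) (auto simp: in_keys_iff)

lemma wt_add: "wt w (\<gamma> + \<delta>) = wt w \<gamma> + wt w \<delta>"
proof -
  let ?S = "Poly_Mapping.keys \<gamma> \<union> Poly_Mapping.keys \<delta>"
  have "wt w (\<gamma> + \<delta>) = (\<Sum>v\<in>?S. real (Poly_Mapping.lookup (\<gamma> + \<delta>) v) * w v)"
    by (rule wt_superset) (auto simp: in_keys_iff lookup_add)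
  moreover have "wt w \<gamma> = (\<Sum>v\<in>?S. real (Poly_Mapping.lookup \<gamma> v) * w v)"
    "wt w \<delta> = (\<Sum>v\<in>?S. real (Poly_Mapping.lookup \<delta> v) * w v)"
    by (rule wt_superset; simp)+
  ultimately show ?thesis by (simp add: lookup_add distrib_right sum.distrib)
qed

lemma wt_0 [simp]: "wt w 0 = 0"
  by (simp add: wt_def)

lemma wt_single [simp]: "wt w (Poly_Mapping.single v n) = real n * w v"
  by (subst wt_superset[of "{v}"]) auto

lemma wt_sum_list: "wt w (\<Sum>x\<leftarrow>xs. f x) = (\<Sum>x\<leftarrow>xs. wt w (f x))"
  by (induction xs) (simp_all add: wt_add)

lemma wt_nonneg: "(\<And>v. 0 \<le> w v) \<Longrightarrow> 0 \<le> wt w \<gamma>"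
  by (simp add: wt_def sum_nonneg)

lemma lookup_times_weight_le_wt:
  assumes "\<And>v. 0 \<le> w v"
  shows "real (Poly_Mapping.lookup \<gamma> v) * w v \<le> wt w \<gamma>"
proof (cases "v \<in> Poly_Mapping.keys \<gamma>")
  case True
  then show ?thesis unfolding wt_def using assms
    by (intro member_le_sum[of v _ "\<lambda>v. real (Poly_Mapping.lookup \<gamma> v) * w v"]) auto
qed (simp add: in_keys_iff wt_nonneg assms)

lemma weight_le_wt:
  assumes "\<And>v. 0 \<le> w v" "v \<in> Poly_Mapping.keys \<gamma>"
  shows "w v \<le> wt w \<gamma>"
proof -
  have "1 * w v \<le> real (Poly_Mapping.lookup \<gamma> v) * w v"
    using assms by (intro mult_right_mono) (auto simp: in_keys_iff Suc_le_eq)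
  then show ?thesis using lookup_times_weight_le_wt[of w \<gamma> v, OF assms(1)] by linarith
qed

text \<open>A variable heavier than \<open>C\<close> cannot occur in such a monomial, and every
  exponent is at most \<open>C / e\<close>. This leaves finitely many functions with support in a
  fixed finite set and bounded values.\<close>

lemma finite_wt_le:
  assumes "0 < e" "\<And>v. e \<le> w v" "finite {v. w v \<le> C}"
  shows "finite {\<gamma>. wt w \<gamma> \<le> C}"
proof (rule finite_imageD)
  have w: "0 \<le> w v" for v using assms(1) assms(2)[of v] by simp
  let ?F = "{f. \<forall>v. (v \<in> {v. w v \<le> C} \<longrightarrow> f v \<in> {..nat \<lfloor>C / e\<rfloor>}) \<and> (v \<notin> {v. w v \<le> C} \<longrightarrow> f v = 0)}"
  show "finite (Poly_Mapping.lookup ` {\<gamma>. wt w \<gamma> \<le> C})"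
  proof (rule finite_subset)
    show "finite ?F" by (rule finite_set_of_finite_funs) (use assms(3) in auto)
    show "Poly_Mapping.lookup ` {\<gamma>. wt w \<gamma> \<le> C} \<subseteq> ?F"
    proof clarsimp
      fix \<gamma> :: "'a \<Rightarrow>\<^sub>0 nat" and v assume C: "wt w \<gamma> \<le> C"
      have "real (Poly_Mapping.lookup \<gamma> v) * e \<le> real (Poly_Mapping.lookup \<gamma> v) * w v"
        using assms(2) by (intro mult_left_mono) auto
      also have "\<dots> \<le> C" using lookup_times_weight_le_wt[of w \<gamma> v, OF w] C by linarith
      finally have "Poly_Mapping.lookup \<gamma> v \<le> nat \<lfloor>C / e\<rfloor>"
        using assms(1) by (simp add: le_nat_floor pos_le_divide_eq)
      moreover have "Poly_Mapping.lookup \<gamma> v = 0" if "\<not> w v \<le> C"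
        using weight_le_wt[of w v \<gamma>] w C that by (auto simp: in_keys_iff)
      ultimately show "(w v \<le> C \<longrightarrow> Poly_Mapping.lookup \<gamma> v \<le> nat \<lfloor>C / e\<rfloor>) \<and>
          (\<not> w v \<le> C \<longrightarrow> Poly_Mapping.lookup \<gamma> v = 0)" by blast
    qed
  qed
qed (simp add: inj_on_def poly_mapping_eqI)

section \<open>The weights of the variables\<close>

text \<open>Compared with \<open>homog\<close>, the variable \<open>ZN k\<close> weighs
  \<open>k\<close> more. Thus only finitely many variables lie below a given weight, and the shift
  from \<open>ZN k\<close> to \<open>ZN (k + 1)\<close> raises the weight.\<close>

fun var_weight :: "real \<Rightarrow> 'd::finite zvar \<Rightarrow> real" where
  "var_weight \<alpha> (ZN k) = \<alpha> + real k"
| "var_weight \<alpha> (ZV v) = real (deg (vec_of v))"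

lemma deg_add: "deg (n + m) = deg n + deg m"
  by (simp add: deg_def sum.distrib)

lemma deg_axis: "deg (axis i k) = k"
  by (simp add: deg_def axis_nth_if)

lemma deg_eq_0_iff: "deg n = 0 \<longleftrightarrow> n = 0" for n :: "nat ^ 'd::finite"
  by (simp add: deg_def vec_eq_iff)

lemma finite_deg_le: "finite {n :: nat ^ 'd::finite. deg n \<le> N}"
proof (rule finite_imageD)
  show "finite (vec_nth ` {n :: nat ^ 'd. deg n \<le> N})"
  proof (rule finite_subset)
    show "finite ((UNIV :: 'd set) \<rightarrow>\<^sub>E {..N})" by (intro finite_PiE) auto
    show "vec_nth ` {n :: nat ^ 'd. deg n \<le> N} \<subseteq> UNIV \<rightarrow>\<^sub>E {..N}"
    proof -
      have "n $ i \<le> deg n" for n :: "nat ^ 'd" and i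
        unfolding deg_def by (rule member_le_sum) auto
      then show ?thesis by (auto simp: PiE_UNIV_domain intro: order_trans)
    qed
  qed
qed (simp add: inj_on_def vec_nth_inject)

text \<open>The index of a variable \<open>ZV\<close> is a nonzero vector, so its degree is at least
  1 and exceeds \<alpha>.\<close>

lemma var_weight_ge:
  assumes "\<alpha> < 1"
  shows "\<alpha> \<le> var_weight \<alpha> v"
proof (cases v)
  case (ZV p)
  have "deg (vec_of p) \<noteq> 0" using vec_of[of p] by (simp add: deg_eq_0_iff)
  then show ?thesis using assms ZV by simp
qed simp

lemma finite_var_weight_le:
  assumes "0 < \<alpha>"
  shows "finite {v :: 'd::finite zvar. var_weight \<alpha> v \<le> C}"
proof (rule finite_subset)
  let ?N = "nat \<lfloor>C\<rfloor>"
  \<comment> \<open>The unspecified value \<open>pos_of 0\<close> merely enlarges the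
    superset.\<close>
  show "{v :: 'd zvar. var_weight \<alpha> v \<le> C} \<subseteq> ZN ` {..?N} \<union> (\<lambda>n. ZV (pos_of n)) ` {n. deg n \<le> ?N}"
  proof
    fix v :: "'d zvar" assume v: "v \<in> {v. var_weight \<alpha> v \<le> C}"
    show "v \<in> ZN ` {..?N} \<union> (\<lambda>n. ZV (pos_of n)) ` {n. deg n \<le> ?N}"
    proof (cases v)
      case (ZN k)
      then have "k \<le> ?N" using v assms by (intro le_nat_floor) simp
      then show ?thesis using ZN by simp
    next
      case (ZV p)
      then have "deg (vec_of p) \<le> ?N" using v by (auto intro: le_nat_floor)
      then show ?thesis using ZV by (auto simp: vec_of_inverse intro!: image_eqI[of _ _ "vec_of p"])
    qed
  qed
qed (simp add: finite_deg_le)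

text \<open>The difference is the sum of \<open>k\<close> times the exponent of \<open>ZN k\<close>.
  The bound turns the condition on \<gamma> and n in \<open>L_basis\<close> into a strict inequality
  for weights.\<close>

lemma homog_le_wt: "homog \<alpha> \<gamma> \<le> wt (var_weight \<alpha>) \<gamma>"
proof -
  let ?K = "ZN -` Poly_Mapping.keys \<gamma>" and ?V = "ZV -` Poly_Mapping.keys \<gamma>"
  have fin: "finite ?K" "finite ?V" by (auto intro!: finite_vimageI simp: inj_on_def)
  have keys: "Poly_Mapping.keys \<gamma> = ZN ` ?K \<union> ZV ` ?V"
    by (auto simp: image_iff) (metis zvar.exhaust)
  have "Sum_any (\<lambda>k. Poly_Mapping.lookup \<gamma> (ZN k)) = (\<Sum>k\<in>?K. Poly_Mapping.lookup \<gamma> (ZN k))"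
    "Sum_any (\<lambda>v. deg (vec_of v) * Poly_Mapping.lookup \<gamma> (ZV v)) = (\<Sum>v\<in>?V. deg (vec_of v) * Poly_Mapping.lookup \<gamma> (ZV v))"
    by (rule Sum_any.expand_superset; use fin in \<open>auto simp: in_keys_iff\<close>)+
  then have "homog \<alpha> \<gamma> = (\<Sum>k\<in>?K. real (Poly_Mapping.lookup \<gamma> (ZN k)) * \<alpha>)
      + (\<Sum>v\<in>?V. real (Poly_Mapping.lookup \<gamma> (ZV v)) * real (deg (vec_of v)))"
    by (simp add: homog_def sum_distrib_left mult.commute)
  also have "\<dots> \<le> (\<Sum>k\<in>?K. real (Poly_Mapping.lookup \<gamma> (ZN k)) * (\<alpha> + real k))
      + (\<Sum>v\<in>?V. real (Poly_Mapping.lookup \<gamma> (ZV v)) * real (deg (vec_of v)))"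
    by (intro add_right_mono sum_mono mult_left_mono) auto
  also have "\<dots> = wt (var_weight \<alpha>) \<gamma>"
    unfolding wt_def
    by (subst keys, subst sum.union_disjoint) (use fin in \<open>auto simp: sum.reindex inj_on_def simp del: image_vimage_eq\<close>)
  finally show ?thesis .
qed

section \<open>The weight filtration of the polynomial algebra\<close>

text \<open>A decreasing filtration by least weight. The zero polynomial lies in every level, so
  each level is a subspace.\<close>

definition filt :: "('d::finite zvar \<Rightarrow> real) \<Rightarrow> real \<Rightarrow> 'd alg set" where
  "filt w c = {a. \<forall>\<mu>\<in>Poly_Mapping.keys a. c \<le> wt w \<mu>}"

lemma subspace_filt: "subspace (filt w c)"
  unfolding subspace_def filt_def
  using keys_add by (auto simp: in_keys_iff lookup_add)

lemma zpow_in_filt [simp]: "zpow \<gamma> \<in> filt w c \<longleftrightarrow> c \<le> wt w \<gamma>"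
  by (simp add: filt_def zpow_def)

lemma filt_mono: "a \<in> filt w c \<Longrightarrow> c' \<le> c \<Longrightarrow> a \<in> filt w c'"
  by (force simp: filt_def)

lemma filt_mult:
  assumes "a \<in> filt w c" "b \<in> filt w c'"
  shows "a * b \<in> filt w (c + c')"
  unfolding filt_def
proof clarify
  fix \<mu> assume "\<mu> \<in> Poly_Mapping.keys (a * b)"
  then obtain \<gamma> \<delta> where "\<mu> = \<gamma> + \<delta>" "\<gamma> \<in> Poly_Mapping.keys a" "\<delta> \<in> Poly_Mapping.keys b"
    using keys_mult[of a b] by blast
  then show "c + c' \<le> wt w \<mu>" using assms by (auto simp: filt_def wt_add intro!: add_mono)
qed

lemma pd_in_filt:
  assumes "a \<in> filt w c"
  shows "pd v a \<in> filt w (c - w v)"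
  unfolding pd_def lin_ext_def
proof (rule subspace_sum[OF subspace_filt], rule subspace_scale[OF subspace_filt])
  fix \<gamma> assume "\<gamma> \<in> Poly_Mapping.keys a"
  then have c: "c \<le> wt w \<gamma>" using assms by (auto simp: filt_def)
  show "real (Poly_Mapping.lookup \<gamma> v) *\<^sub>R zpow (\<gamma> - Poly_Mapping.single v 1) \<in> filt w (c - w v)"
  \<comment> \<open>If the exponent of \<open>v\<close> is 0, the truncated difference leaves
    \<gamma> unchanged, but the coefficient vanishes.\<close>
  proof (cases "Poly_Mapping.lookup \<gamma> v = 0")
    case True
    then show ?thesis by (simp add: subspace_0[OF subspace_filt])
  next
    case False
    then have "\<gamma> = (\<gamma> - Poly_Mapping.single v 1) + Poly_Mapping.single v 1"
      by (intro poly_mapping_eqI) (auto simp: lookup_add lookup_minus lookup_single when_def)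
    then have "wt w \<gamma> = wt w (\<gamma> - Poly_Mapping.single v 1) + w v"
      by (metis wt_add wt_single mult_1 of_nat_1)
    then show ?thesis using c by (intro subspace_scale[OF subspace_filt]) simp
  qed
qed

lemma Sum_any_in_filt: "(\<And>k. f k \<in> filt w c) \<Longrightarrow> Sum_any f \<in> filt w c"
  unfolding Sum_any.expand_set by (intro subspace_sum[OF subspace_filt])

lemma zN_in_filt: "zN k \<in> filt (var_weight \<alpha>) (\<alpha> + real k)"
  by (simp add: zN_def)

lemma zV_in_filt: "n \<noteq> 0 \<Longrightarrow> zV n \<in> filt (var_weight \<alpha>) (real (deg n))"
  by (simp add: zV_def pos_of_inverse)

lemma D_op_in_filt:
  assumes "a \<in> filt (var_weight \<alpha>) c"
  shows "D_op n a \<in> filt (var_weight \<alpha>) (c - real (deg n))"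
proof (cases "n = 0")
  case True
  \<comment> \<open>Differentiation costs \<open>\<alpha> + k\<close> and multiplication gains
    \<open>\<alpha> + k + 1\<close>; the surplus 1 is given away.\<close>
  have "zN (k + 1) * pd (ZN k) a \<in> filt (var_weight \<alpha>) (c - real (deg n))" for k
    using filt_mult[OF zN_in_filt pd_in_filt[OF assms], of "k + 1" "ZN k"]
    by (rule filt_mono) (simp add: True)
  then show ?thesis unfolding D_op_def
    by (simp add: True Sum_any_in_filt subspace_scale[OF subspace_filt])
next
  case False
  then show ?thesis using pd_in_filt[OF assms, of "ZV (pos_of n)"]
    by (simp add: D_op_def pos_of_inverse)
qed

text \<open>In each summand \<open>D_op n\<close> costs at most \<open>deg n\<close>, while the
  factor \<open>zV (n + axis i 1)\<close> gains \<open>deg n + 1\<close>. The net gain does not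
  depend on \<open>n\<close>.\<close>

lemma partial_op_in_filt:
  assumes "a \<in> filt (var_weight \<alpha>) c"
  shows "partial_op i a \<in> filt (var_weight \<alpha>) (c + 1)"
proof -
  have "zV (n + axis i 1) * D_op n a \<in> filt (var_weight \<alpha>) (c + 1)" for n
    using filt_mult[OF zV_in_filt D_op_in_filt[OF assms], of "n + axis i 1" n]
    by (simp add: deg_add deg_axis add.commute)
  then show ?thesis unfolding partial_op_def
    by (intro Sum_any_in_filt subspace_scale[OF subspace_filt])
qed

section \<open>Words with the partial derivatives last\<close>

text \<open>Every correction term of \<open>Psi\<close> has a zero entry and vanishes by
  multilinearity.\<close>

lemma Psi_Cons_diamond_0:
  assumes "\<And>Y. Y \<in> set Ys \<Longrightarrow> X \<diamondop> Y = 0"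
  shows "Psi (X # Ys) b = der_op X (Psi Ys b)"
proof -
  have "Psi (Ys[i := X \<diamondop> Ys ! i]) b = 0" if "i < length Ys" for i
    using linear_0[OF linear_Psi_slot[OF that]] assms that by simp
  then show ?thesis by simp
qed

lemma Psi_partials:
  assumes "b \<in> filt (var_weight \<alpha>) c"
  shows "Psi (map (\<lambda>i. bas (PG i)) is) b \<in> filt (var_weight \<alpha>) (c + real (length is))"
proof (induction "is")
  case (Cons i "is")
  have "Psi (map (\<lambda>i. bas (PG i)) (i # is)) b = partial_op i (Psi (map (\<lambda>i. bas (PG i)) is) b)"
    by (simp only: list.map, subst Psi_Cons_diamond_0) auto
  then show ?case using partial_op_in_filt[OF Cons, of i] by (simp add: add_ac)
qed (simp add: assms)

text \<open>The only nonzero products on generators are of the form \<open>PG i\<close> \<diamondop>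
  \<open>DG n\<close>. With all \<open>PG\<close> entries behind the \<open>DG\<close> entries they
  never arise, so \<open>Psi\<close> composes the operators and the filtration bounds add
  up.\<close>

lemma Psi_Ds_partials:
  assumes "b \<in> filt (var_weight \<alpha>) c"
  shows "Psi (map (\<lambda>n. bas (DG n)) ns @ map (\<lambda>i. bas (PG i)) is) b
    \<in> filt (var_weight \<alpha>) (c + real (length is) - real (\<Sum>n\<leftarrow>ns. deg n))"
proof (induction ns)
  case Nil
  then show ?case using Psi_partials[OF assms] by simp
next
  case (Cons n ns)
  have "Psi (map (\<lambda>n. bas (DG n)) (n # ns) @ map (\<lambda>i. bas (PG i)) is) b
    = D_op n (Psi (map (\<lambda>n. bas (DG n)) ns @ map (\<lambda>i. bas (PG i)) is) b)"
    by (simp only: list.map append_Cons, subst Psi_Cons_diamond_0) auto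
  then show ?case using D_op_in_filt[OF Cons, of n] by (simp add: algebra_simps)
qed

section \<open>Basis monomials of Sym(L) with sorted factors\<close>

text \<open>Lists with repetitions replace exponents, so that \<open>rho_prod\<close> applies
  directly.\<close>

definition sym_monom :: "('d::finite mon \<times> (nat ^ 'd)) list \<Rightarrow> 'd list \<Rightarrow> 'd sym" where
  "sym_monom qs is = (\<Prod>(\<gamma>, n)\<leftarrow>qs. iota (tensor (zpow \<gamma>) (bas (DG n)))) *
     (\<Prod>i\<leftarrow>is. iota (tensor 1 (bas (PG i))))"

lemma sym_monom_append: "sym_monom qs is * sym_monom qs' is' = sym_monom (qs @ qs') (is @ is')"
  by (simp add: sym_monom_def ac_simps)

text \<open>The sorted products contain 1 and the images under \<open>iota\<close> of
  \<open>L_basis\<close>. They are closed under multiplication because Sym(L) is commutative, so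
  they contain every basis monomial.\<close>

lemma Sym_L_basis_cases:
  fixes u :: "'d::finite sym"
  assumes "u \<in> Sym_L_basis \<alpha>"
  obtains qs "is" where "u = sym_monom qs is" "\<forall>(\<gamma>, n)\<in>set qs. real (deg n) < homog \<alpha> \<gamma>"
proof -
  define G :: "'d sym set" where "G = {sym_monom qs is | qs is. \<forall>(\<gamma>, n)\<in>set qs. real (deg n) < homog \<alpha> \<gamma>}"
  have mult: "p * q \<in> G" if pq: "p \<in> G" "q \<in> G" for p q
  proof -
    obtain qs "is" where 1: "p = sym_monom qs is" "\<forall>(\<gamma>, n)\<in>set qs. real (deg n) < homog \<alpha> \<gamma>"
      using pq(1) unfolding G_def by blast
    obtain qs' is' where 2: "q = sym_monom qs' is'" "\<forall>(\<gamma>, n)\<in>set qs'. real (deg n) < homog \<alpha> \<gamma>"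
      using pq(2) unfolding G_def by blast
    have "p * q = sym_monom (qs @ qs') (is @ is')" by (simp only: 1 2 sym_monom_append)
    then show ?thesis using 1 2 unfolding G_def mem_Collect_eq
      by (intro exI[of _ "qs @ qs'"] exI[of _ "is @ is'"]) auto
  qed
  have one: "1 \<in> G" unfolding G_def mem_Collect_eq
    by (intro exI[of _ "[]"]) (simp add: sym_monom_def)
  have base: "iota x \<in> G" if "x \<in> L_basis \<alpha>" for x
    using that unfolding L_basis_def
  proof (elim UnE CollectE exE conjE)
    fix i assume "x = tensor 1 (bas (PG i))"
    then show ?thesis unfolding G_def mem_Collect_eq
      by (intro exI[of _ "[]"] exI[of _ "[i]"]) (simp add: sym_monom_def)
  next
    fix \<gamma> n assume "x = tensor (zpow \<gamma>) (bas (DG n))" "real (deg n) < homog \<alpha> \<gamma>"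
    then show ?thesis unfolding G_def mem_Collect_eq
      by (intro exI[of _ "[(\<gamma>, n)]"] exI[of _ "[]"]) (simp add: sym_monom_def)
  qed
  have pow: "p ^ k \<in> G" if "p \<in> G" for p and k :: nat
    using that by (induction k) (auto simp: one mult)
  obtain X m where X: "finite X" "X \<subseteq> L_basis \<alpha>" "u = (\<Prod>x\<in>X. iota x ^ m x)"
    using assms unfolding Sym_L_basis_def by blast
  have "u \<in> G" unfolding X(3) using X(1,2)
    by (induction X rule: finite_induct) (auto simp: one intro!: mult pow base)
  then show thesis using that unfolding G_def by blast
qed

lemma rho_sym_monom:
  "rho (sym_monom qs is) b = zpow (\<Sum>q\<leftarrow>qs. fst q) *
     Psi (map (\<lambda>n. bas (DG n)) (map snd qs) @ map (\<lambda>i. bas (PG i)) is) b"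
proof -
  let ?ps = "map (\<lambda>(\<gamma>, n). (zpow \<gamma>, bas (DG n))) qs @ map (\<lambda>i. (1, bas (PG i))) is"
  have "sym_monom qs is = prod_list (map (\<lambda>(a, X). iota (tensor a X)) ?ps)"
    by (simp add: sym_monom_def case_prod_unfold o_def)
  moreover have "prod_list (map fst ?ps) = zpow (\<Sum>q\<leftarrow>qs. fst q)"
    by (induction qs) (auto simp: o_def zpow_add map_replicate_const)
  moreover have "map snd ?ps = map (\<lambda>n. bas (DG n)) (map snd qs) @ map (\<lambda>i. bas (PG i)) is"
    by (simp add: o_def case_prod_unfold)
  ultimately show ?thesis by (simp only: rho_prod)
qed

lemma pairing_zpow: "pairing a (zpow \<beta>) = Poly_Mapping.lookup a \<beta>"
proof -
  have "pairing a (zpow \<beta>) = Sum_any (\<lambda>\<gamma>. if \<gamma> = \<beta> then Poly_Mapping.lookup a \<gamma> else 0)"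
    unfolding pairing_def zpow_def
    by (rule Sum_any.cong) (simp add: lookup_single when_def)
  then show ?thesis by simp
qed

section \<open>Finiteness\<close>

text \<open>All bounds depend on \<alpha> and \<beta> alone, so they confine \<open>qs\<close>,
  \<open>is\<close> and \<gamma> to finite sets.\<close>

lemma weight_bounds:
  fixes \<beta> :: "'d::finite mon"
  assumes \<alpha>: "0 < \<alpha>" "\<alpha> < 1"
    and qs: "\<forall>(\<gamma>, n)\<in>set qs. real (deg n) < homog \<alpha> \<gamma>"
    and nz: "pairing (rho (sym_monom qs is) (zpow \<gamma>)) (zpow \<beta>) \<noteq> 0"
  defines "W \<equiv> wt (var_weight \<alpha>)"
  shows "W \<gamma> \<le> W \<beta>" "real (length is) \<le> W \<beta>" "real (length qs) * \<alpha> \<le> W \<beta>"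
    "(\<delta>, n) \<in> set qs \<Longrightarrow> W \<delta> \<le> W \<beta> \<and> real (deg n) \<le> W \<beta>"
proof -
  have w: "0 \<le> var_weight \<alpha> v" for v :: "'d zvar"
    using var_weight_ge[OF \<alpha>(2), of v] \<alpha>(1) by linarith
  have W0: "0 \<le> W \<mu>" for \<mu> unfolding W_def by (rule wt_nonneg) (rule w)
  let ?P = "Psi (map (\<lambda>n. bas (DG n)) (map snd qs) @ map (\<lambda>i. bas (PG i)) is) (zpow \<gamma>)"
  have "\<beta> \<in> Poly_Mapping.keys (zpow (\<Sum>q\<leftarrow>qs. fst q) * ?P)"
    using nz by (simp add: pairing_zpow rho_sym_monom in_keys_iff)
  \<comment> \<open>The prefactor is a single monomial, so \<beta> splits into the product of all
    coefficients and a monomial \<eta> produced by \<open>Psi\<close>.\<close>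
  then obtain \<eta> where \<eta>: "\<beta> = (\<Sum>q\<leftarrow>qs. fst q) + \<eta>" "\<eta> \<in> Poly_Mapping.keys ?P"
    using keys_mult[of "zpow (\<Sum>q\<leftarrow>qs. fst q)" ?P] by (auto simp: zpow_def)
  have "?P \<in> filt (var_weight \<alpha>) (W \<gamma> + real (length is) - real (\<Sum>n\<leftarrow>map snd qs. deg n))"
    by (rule Psi_Ds_partials) (simp add: W_def)
  then have lower: "W \<gamma> + real (length is) - (\<Sum>q\<leftarrow>qs. real (deg (snd q))) \<le> W \<eta>"
    using \<eta>(2) by (simp add: filt_def W_def o_def flip: sum_list_of_nat)
  have split: "W \<beta> = (\<Sum>q\<leftarrow>qs. W (fst q)) + W \<eta>"
    by (simp add: \<eta>(1) W_def wt_add wt_sum_list)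
  have deg_less: "real (deg (snd q)) < W (fst q)" if "q \<in> set qs" for q
    using qs that homog_le_wt[of \<alpha> "fst q"] by (force simp: W_def)
  \<comment> \<open>The weights of the coefficients pay for everything the derivations may
    remove.\<close>
  have "(\<Sum>q\<leftarrow>qs. real (deg (snd q))) \<le> (\<Sum>q\<leftarrow>qs. W (fst q))"
    by (rule sum_list_mono) (use deg_less in force)
  with lower split W0[of \<gamma>] show "W \<gamma> \<le> W \<beta>" "real (length is) \<le> W \<beta>" by linarith+
  \<comment> \<open>Positive gaps between weight and degree alone give no uniform bound on the
    length. But each coefficient has positive weight, hence contains a variable, which weighs at
    least \<alpha>.\<close>
  have "\<alpha> \<le> W (fst q)" if "q \<in> set qs" for q
  proof -
    have "W (fst q) \<noteq> 0" using deg_less[OF that] by linarith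
    then obtain v where "v \<in> Poly_Mapping.keys (fst q)" by (force simp: W_def wt_def)
    then show ?thesis
      using weight_le_wt[of "var_weight \<alpha>" v "fst q"] w var_weight_ge[OF \<alpha>(2), of v] by (force simp: W_def)
  qed
  then have "(\<Sum>q\<leftarrow>qs. \<alpha>) \<le> (\<Sum>q\<leftarrow>qs. W (fst q))" by (intro sum_list_mono)
  then show "real (length qs) * \<alpha> \<le> W \<beta>" using split W0[of \<eta>] by (simp add: sum_list_triv)
  show "W \<delta> \<le> W \<beta> \<and> real (deg n) \<le> W \<beta>" if "(\<delta>, n) \<in> set qs"
  proof -
    have "W \<delta> \<le> (\<Sum>q\<leftarrow>qs. W (fst q))"
      by (rule member_le_sum_list) (use that W0 in \<open>force+\<close>)
    then show ?thesis using deg_less[OF that] split W0[of \<eta>] by simp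
  qed
qed

theorem proposition4p8:
  fixes \<alpha> :: real and \<beta> :: "'d::finite mon"
  assumes "0 < \<alpha>" and "\<alpha> < 1"
  shows "finite {(u, a) \<in> Sym_L_basis \<alpha> \<times> A_basis. pairing (rho u a) (zpow \<beta>) \<noteq> 0}"
proof (rule finite_subset)
  define C where "C = wt (var_weight \<alpha>) \<beta>"
  define M where "M = {\<gamma> :: 'd mon. wt (var_weight \<alpha>) \<gamma> \<le> C}"
  define N where "N = {n :: nat ^ 'd. deg n \<le> nat \<lfloor>C\<rfloor>}"
  define Q where "Q = {qs. set qs \<subseteq> M \<times> N \<and> length qs \<le> nat \<lfloor>C / \<alpha>\<rfloor>}"
  define I where "I = {is :: 'd list. set is \<subseteq> UNIV \<and> length is \<le> nat \<lfloor>C\<rfloor>}"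
  have "finite M" unfolding M_def
    using assms by (intro finite_wt_le[of \<alpha>] var_weight_ge finite_var_weight_le)
  moreover have "finite N" unfolding N_def by (rule finite_deg_le)
  ultimately have "finite (Q \<times> I \<times> M)"
    unfolding Q_def I_def by (intro finite_cartesian_product finite_lists_length_le) auto
  \<comment> \<open>Different lists may give the same monomial; the image only has to cover the set
    in question.\<close>
  then show "finite ((\<lambda>(qs, is, \<gamma>). (sym_monom qs is, zpow \<gamma>)) ` (Q \<times> I \<times> M))"
    by (rule finite_imageI)
  show "{(u, a) \<in> Sym_L_basis \<alpha> \<times> A_basis. pairing (rho u a) (zpow \<beta>) \<noteq> 0}
    \<subseteq> (\<lambda>(qs, is, \<gamma>). (sym_monom qs is, zpow \<gamma>)) ` (Q \<times> I \<times> M)"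
  proof clarify
    fix u :: "'d sym" and a :: "'d alg"
    assume u: "u \<in> Sym_L_basis \<alpha>" and "a \<in> A_basis" and nz: "pairing (rho u a) (zpow \<beta>) \<noteq> 0"
    then obtain \<gamma> where a: "a = zpow \<gamma>" by (auto simp: A_basis_def)
    obtain qs "is" where us: "u = sym_monom qs is" "\<forall>(\<gamma>, n)\<in>set qs. real (deg n) < homog \<alpha> \<gamma>"
      using u by (rule Sym_L_basis_cases)
    note b = weight_bounds[OF assms us(2) nz[unfolded us(1) a], folded C_def]
    have "\<gamma> \<in> M" using b(1) by (simp add: M_def)
    moreover have "is \<in> I" using b(2) by (simp add: I_def le_nat_floor)
    moreover have "qs \<in> Q"
      using b(3,4) assms(1) by (auto simp: Q_def M_def N_def le_nat_floor pos_le_divide_eq)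
    ultimately show "(u, a) \<in> (\<lambda>(qs, is, \<gamma>). (sym_monom qs is, zpow \<gamma>)) ` (Q \<times> I \<times> M)"
      unfolding us(1) a by (intro image_eqI[of _ _ "(qs, is, \<gamma>)"]) auto
  qed
qed

end
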